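(* Let $q\in(0,1)$ and let $W=(W_1,\ldots,W_m)$ be a random score vector with null set $\mathcal H_0\subseteq\{1,\ldots,m\}$ such that every null score is nonzero almost surely. With $d_{\rm sign}$, $K_{\rm sign}$, $\Lambda_{\max}$, $I_q$, $M_{\mathcal H_0}^-$ as defined in the context, the FDR of the knockoff+ threshold run at nominal level $q$, denoted $\mathrm{FDR}(q)$, satisfies $$\mathrm{FDR}(q)\le q+d_{\rm sign}\le q+\sqrt{K_{\rm sign}/2},$$ $$\mathrm{FDR}(q)\le e^{\varepsilon}q+\mathbb P(\Lambda_{\max}>\varepsilon)\qquad\text{for every }\varepsilon\ge0.$$ If, in addition, for every null $j$ both conditional probabilities $\mathbb P(W_j>0\mid|W_j|,W_{-j})$ and $\mathbb P(W_j<0\mid|W_j|,W_{-j})$ are positive almost surely, then $$\mathrm{FDR}(q)\le q\,I_q\le q\,M_{\mathcal H_0}^-.$$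
   Context: For $t>0$, put $N_+(t)=\#\{i:W_i\ge t\}$, $N_-(t)=\#\{i:W_i\le -t\}$, $\mathcal T=\{|W_i|:|W_i|>0\}$. The knockoff+ threshold at level $q$ is $\widehat t=\widehat t(W;q)=\min\{t\in\mathcal T:(1+N_-(t))/(N_+(t)\vee1)\le q\}$, with $\widehat t=\infty$ if the set is empty; the rejection set is $\widehat{\mathcal R}=\{i:W_i\ge\widehat t\}$, and $\mathrm{FDR}=\mathbb E\{|\widehat{\mathcal R}\cap\mathcal H_0|/(|\widehat{\mathcal R}|\vee1)\}$, where $a\vee b=\max\{a,b\}$. Let $\mathcal G=\sigma(|W_1|,\ldots,|W_m|,(W_i)_{i\notin\mathcal H_0})$, let $\nu_{\mathcal G}$ be the conditional law given $\mathcal G$ of the null sign vector $(\operatorname{sign}W_i)_{i\in\mathcal H_0}$, and let $\nu^\circ_{\mathcal G}$ be the law of independent fair signs on the same coordinates. Put $d_{\rm sign}=\mathbb E\{d_{\rm TV}(\nu_{\mathcal G},\nu^\circ_{\mathcal G})\}$ and $K_{\rm sign}=\mathbb E\{D_{\rm KL}(\nu_{\mathcal G}\|\nu^\circ_{\mathcal G})\}$ (total variation distance and Kullback–Leibler divergence). $W_{-j}$ denotes all scores except $W_j$. For each null $j$, $$\Lambda_j=\log\frac{\mathbb P(W_j>0\mid|W_j|,W_{-j})}{\mathbb P(W_j<0\mid|W_j|,W_{-j})},\qquad \Lambda_{\max}=\max_{j\in\mathcal H_0}\Lambda_j,$$ with $\Lambda_j=+\infty$ if the denominator is zero, $\Lambda_j=-\infty$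 if the numerator is zero, and $\max\varnothing=-\infty$. Put $\Omega_j=e^{\Lambda_j}$. For null $j$, let $W^{(j)}$ be $W$ with $W_j$ replaced by $|W_j|$, let $\widehat t_j(q)=\widehat t(W^{(j)};q)$, and let $\mathcal A_q=\{j\in\mathcal H_0:W_j\le-\widehat t_j(q)\}$. Define $$I_q=\mathbb E\Big[\mathbf 1\{\mathcal A_q\ne\varnothing\}\frac1{|\mathcal A_q|}\sum_{j\in\mathcal A_q}\Omega_j\Big],\qquad M_{\mathcal H_0}^-=\mathbb E\Big[1\vee\max_{j\in\mathcal H_0,\,W_j<0}\Omega_j\Big],$$ where the inner maximum is zero when its index set is empty. These quantities may be infinite. *)

theory Defs
  imports "HOL-Probability.Probability"
begin

definition N_plus :: "nat set \<Rightarrow> (nat \<Rightarrow> real) \<Rightarrow> real \<Rightarrow> nat" where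
  "N_plus I w t = card {i \<in> I. w i \<ge> t}"

definition N_minus :: "nat set \<Rightarrow> (nat \<Rightarrow> real) \<Rightarrow> real \<Rightarrow> nat" where
  "N_minus I w t = card {i \<in> I. w i \<le> - t}"

definition admissible_thresholds :: "nat set \<Rightarrow> real \<Rightarrow> (nat \<Rightarrow> real) \<Rightarrow> real set" where
  "admissible_thresholds I q w =
     {t \<in> {\<bar>w i\<bar> |i. i \<in> I \<and> \<bar>w i\<bar> > 0}.
        (1 + real (N_minus I w t)) / max (real (N_plus I w t)) 1 \<le> q}"

definition knockoff_threshold :: "nat set \<Rightarrow> real \<Rightarrow> (nat \<Rightarrow> real) \<Rightarrow> ereal" where
  "knockoff_threshold I q w =
     (if admissible_thresholds I q w = {} then \<infinity>
      else ereal (Min (admissible_thresholds I q w)))"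

definition rejections :: "nat set \<Rightarrow> real \<Rightarrow> (nat \<Rightarrow> real) \<Rightarrow> nat set" where
  "rejections I q w = {i \<in> I. ereal (w i) \<ge> knockoff_threshold I q w}"

definition FDR :: "'a measure \<Rightarrow> nat set \<Rightarrow> nat set \<Rightarrow> (nat \<Rightarrow> 'a \<Rightarrow> real) \<Rightarrow> real \<Rightarrow> real" where
  "FDR M I H0 W q =
     (\<integral>\<omega>. real (card (rejections I q (\<lambda>i. W i \<omega>) \<inter> H0))
          / max (real (card (rejections I q (\<lambda>i. W i \<omega>)))) 1 \<partial>M)"

definition gen_algebra :: "'a measure \<Rightarrow> ('a \<Rightarrow> real) set \<Rightarrow> 'a measure" where
  "gen_algebra M Xs = sigma (space M) {X -` B \<inter> space M |X B. X \<in> Xs \<and> B \<in> sets borel}"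

lemma subalgebra_gen_algebra:
  assumes "\<And>X. X \<in> Xs \<Longrightarrow> X \<in> borel_measurable M"
  shows "subalgebra M (gen_algebra M Xs)"
proof -
  have sub: "{X -` B \<inter> space M |X B. X \<in> Xs \<and> B \<in> sets borel} \<subseteq> sets M"
    using assms by (auto intro: measurable_sets)
  then have "{X -` B \<inter> space M |X B. X \<in> Xs \<and> B \<in> sets borel} \<subseteq> Pow (space M)"
    using sets.space_closed by blast
  with sub show ?thesis
    unfolding gen_algebra_def subalgebra_def
    by (auto simp: space_measure_of sets_measure_of intro: sets.sigma_sets_subset[THEN subsetD])
qed

definition cprob :: "'a measure \<Rightarrow> 'a measure \<Rightarrow> ('a \<Rightarrow> bool) \<Rightarrow> 'a \<Rightarrow> real" where
  "cprob M F P = real_cond_exp M F (indicator {\<omega> \<in> space M. P \<omega>})"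

text \<open>
  The conditional law given \<open>F\<close> of a random element \<open>X\<close> of the finite set \<open>S\<close>. As versions of
  conditional probabilities are only determined almost everywhere, this is a probability
  measure for almost all \<open>\<omega>\<close>; see \<open>cond_law_version\<close> below.
\<close>

definition cond_law :: "'a measure \<Rightarrow> 'a measure \<Rightarrow> 'b set \<Rightarrow> ('a \<Rightarrow> 'b) \<Rightarrow> 'a \<Rightarrow> 'b measure" where
  "cond_law M F S X \<omega> = point_measure S (\<lambda>s. ennreal (cprob M F (\<lambda>\<omega>'. X \<omega>' = s) \<omega>))"

lemma cprob_nonneg:
  assumes "prob_space M" "subalgebra M F" "{\<omega> \<in> space M. P \<omega>} \<in> sets M"
  shows "AE \<omega> in M. 0 \<le> cprob M F P \<omega>"
proof -
  interpret prob_space M by fact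
  interpret finite_measure_subalgebra M F by unfold_locales fact
  show ?thesis
    unfolding cprob_def using assms(3) by (intro real_cond_exp_pos) auto
qed

lemma cond_law_version:
  assumes M: "prob_space M" and F: "subalgebra M F" and S: "finite S"
    and X: "X \<in> measurable M (count_space S)" and A: "A \<subseteq> S"
  shows "AE \<omega> in M. measure (cond_law M F S X \<omega>) A = cprob M F (\<lambda>\<omega>'. X \<omega>' \<in> A) \<omega>"
proof -
  interpret prob_space M by fact
  interpret finite_measure_subalgebra M F by unfold_locales fact
  have fin: "finite A" using A S by (rule finite_subset)
  have m: "{\<omega> \<in> space M. X \<omega> = s} \<in> sets M" if "s \<in> A" for s
  proof -
    have "X -` {s} \<inter> space M \<in> sets M"
      using that A X by (intro measurable_sets[OF X]) auto
    then show ?thesis by (simp add: vimage_def Int_def conj_commute)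
  qed
  let ?f = "\<lambda>s. indicator {\<omega> \<in> space M. X \<omega> = s} :: 'a \<Rightarrow> real"
  have nn: "AE \<omega> in M. \<forall>s\<in>A. 0 \<le> cprob M F (\<lambda>\<omega>'. X \<omega>' = s) \<omega>"
    using fin m by (intro AE_finite_allI) (auto intro!: cprob_nonneg M F)
  have eq: "indicator {\<omega> \<in> space M. X \<omega> \<in> A} = (\<lambda>\<omega>. \<Sum>s\<in>A. ?f s \<omega>)"
  proof
    fix \<omega>
    show "indicator {\<omega> \<in> space M. X \<omega> \<in> A} \<omega> = (\<Sum>s\<in>A. ?f s \<omega>)"
      using fin by (cases "\<omega> \<in> space M") (simp_all add: indicator_def)
  qed
  have "AE \<omega> in M. cprob M F (\<lambda>\<omega>'. X \<omega>' \<in> A) \<omega> = (\<Sum>s\<in>A. cprob M F (\<lambda>\<omega>'. X \<omega>' = s) \<omega>)"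
  proof -
    have "integrable M (if s \<in> A then ?f s else (\<lambda>_. 0))" for s
      using m by (auto intro!: integrable_real_indicator simp: emeasure_eq_measure)
    then have "AE \<omega> in M. real_cond_exp M F (\<lambda>\<omega>. \<Sum>s\<in>A. (if s \<in> A then ?f s else (\<lambda>_. 0)) \<omega>) \<omega>
        = (\<Sum>s\<in>A. real_cond_exp M F (if s \<in> A then ?f s else (\<lambda>_. 0)) \<omega>)"
      by (rule real_cond_exp_sum)
    moreover have "(\<Sum>s\<in>A. (if s \<in> A then ?f s else (\<lambda>_. 0)) \<omega>) = (\<Sum>s\<in>A. ?f s \<omega>)" for \<omega>
      by (intro sum.cong) auto
    ultimately show ?thesis unfolding cprob_def eq by simp
  qed
  with nn show ?thesis
    by eventually_elim
      (simp add: cond_law_def measure_def emeasure_point_measure_finite[OF S A] sum_ennreal sum_nonneg)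
qed

definition tv_dist :: "'b measure \<Rightarrow> 'b measure \<Rightarrow> real" where
  "tv_dist P Q = (SUP A\<in>sets P. \<bar>measure P A - measure Q A\<bar>)"

text \<open>
  Signs take values in \<open>{-1, 0, 1}\<close>; the value \<open>0\<close> is kept so that the conditional
  law of the null signs has total mass one without any assumption on the scores.
\<close>

definition sign_vectors :: "nat set \<Rightarrow> (nat \<Rightarrow> real) set" where
  "sign_vectors H0 = (\<Pi>\<^sub>E j\<in>H0. {-1, 0, 1})"

definition fair_signs :: "nat set \<Rightarrow> (nat \<Rightarrow> real) measure" where
  "fair_signs H0 = (\<Pi>\<^sub>M j\<in>H0. uniform_measure (count_space {-1, 0, 1}) {-1, 1})"

definition null_signs :: "nat set \<Rightarrow> (nat \<Rightarrow> 'a \<Rightarrow> real) \<Rightarrow> 'a \<Rightarrow> (nat \<Rightarrow> real)" where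
  "null_signs H0 W \<omega> = (\<lambda>j\<in>H0. sgn (W j \<omega>))"

definition null_sign_law ::
  "'a measure \<Rightarrow> nat set \<Rightarrow> nat set \<Rightarrow> (nat \<Rightarrow> 'a \<Rightarrow> real) \<Rightarrow> 'a \<Rightarrow> (nat \<Rightarrow> real) measure" where
  "null_sign_law M I H0 W =
     cond_law M
       (gen_algebra M ({(\<lambda>\<omega>. \<bar>W i \<omega>\<bar>) |i. i \<in> I} \<union> {W i |i. i \<in> I - H0}))
       (sign_vectors H0) (null_signs H0 W)"

lemma sets_fair_signs:
  assumes "finite H0"
  shows "sets (fair_signs H0) = Pow (sign_vectors H0)"
proof -
  have "sets (fair_signs H0) = sets (\<Pi>\<^sub>M j\<in>H0. count_space {-1, 0, 1})"
    unfolding fair_signs_def by (intro sets_PiM_cong) auto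
  then show ?thesis
    using assms by (simp add: count_space_PiM_finite sign_vectors_def)
qed

lemma sets_null_sign_law: "sets (null_sign_law M I H0 W \<omega>) = Pow (sign_vectors H0)"
  by (simp add: null_sign_law_def cond_law_def sets_point_measure)

definition d_sign :: "'a measure \<Rightarrow> nat set \<Rightarrow> nat set \<Rightarrow> (nat \<Rightarrow> 'a \<Rightarrow> real) \<Rightarrow> real" where
  "d_sign M I H0 W = (\<integral>\<omega>. tv_dist (null_sign_law M I H0 W \<omega>) (fair_signs H0) \<partial>M)"

text \<open>
  \<open>KL_divergence b P Q\<close> is the divergence of \<open>Q\<close> from \<open>P\<close>, so the reference law comes first.
  It is meaningful only if \<open>Q\<close> is absolutely continuous with respect to \<open>P\<close>. If the null
  scores are almost surely nonzero, the conditional sign law is almost surely concentrated on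
  vectors without zeros, where the fair law has mass \<open>2 ^ - card H0\<close>; hence it is absolutely
  continuous and the divergence is at most \<open>card H0 * ln 2\<close>.
\<close>

definition K_sign :: "'a measure \<Rightarrow> nat set \<Rightarrow> nat set \<Rightarrow> (nat \<Rightarrow> 'a \<Rightarrow> real) \<Rightarrow> real" where
  "K_sign M I H0 W =
     (\<integral>\<omega>. KL_divergence (exp 1) (fair_signs H0) (null_sign_law M I H0 W \<omega>) \<partial>M)"

definition leave_sign_algebra ::
  "'a measure \<Rightarrow> nat set \<Rightarrow> (nat \<Rightarrow> 'a \<Rightarrow> real) \<Rightarrow> nat \<Rightarrow> 'a measure" where
  "leave_sign_algebra M I W j =
     gen_algebra M (insert (\<lambda>\<omega>. \<bar>W j \<omega>\<bar>) {W i |i. i \<in> I - {j}})"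

definition pos_prob :: "'a measure \<Rightarrow> nat set \<Rightarrow> (nat \<Rightarrow> 'a \<Rightarrow> real) \<Rightarrow> nat \<Rightarrow> 'a \<Rightarrow> real" where
  "pos_prob M I W j = cprob M (leave_sign_algebra M I W j) (\<lambda>\<omega>. W j \<omega> > 0)"

definition neg_prob :: "'a measure \<Rightarrow> nat set \<Rightarrow> (nat \<Rightarrow> 'a \<Rightarrow> real) \<Rightarrow> nat \<Rightarrow> 'a \<Rightarrow> real" where
  "neg_prob M I W j = cprob M (leave_sign_algebra M I W j) (\<lambda>\<omega>. W j \<omega> < 0)"

text \<open>
  Chosen versions of conditional probabilities may be negative, or both be zero, but only on a
  null set when \<open>W j\<close> is almost surely nonzero; the value of \<open>Lambda\<close> there is immaterial.
\<close>

definition Lambda :: "'a measure \<Rightarrow> nat set \<Rightarrow> (nat \<Rightarrow> 'a \<Rightarrow> real) \<Rightarrow> nat \<Rightarrow> 'a \<Rightarrow> ereal" where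
  "Lambda M I W j \<omega> =
     (if neg_prob M I W j \<omega> = 0 then \<infinity>
      else if pos_prob M I W j \<omega> = 0 then - \<infinity>
      else ereal (ln (pos_prob M I W j \<omega> / neg_prob M I W j \<omega>)))"

definition Lambda_max ::
  "'a measure \<Rightarrow> nat set \<Rightarrow> nat set \<Rightarrow> (nat \<Rightarrow> 'a \<Rightarrow> real) \<Rightarrow> 'a \<Rightarrow> ereal" where
  "Lambda_max M I H0 W \<omega> = Max (insert (- \<infinity>) ((\<lambda>j. Lambda M I W j \<omega>) ` H0))"

definition exp_ereal :: "ereal \<Rightarrow> ennreal" where
  "exp_ereal x = (case x of ereal r \<Rightarrow> ennreal (exp r) | PInfty \<Rightarrow> \<infinity> | MInfty \<Rightarrow> 0)"

definition Omega :: "'a measure \<Rightarrow> nat set \<Rightarrow> (nat \<Rightarrow> 'a \<Rightarrow> real) \<Rightarrow> nat \<Rightarrow> 'a \<Rightarrow> ennreal" where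
  "Omega M I W j \<omega> = exp_ereal (Lambda M I W j \<omega>)"

definition A_set :: "nat set \<Rightarrow> nat set \<Rightarrow> real \<Rightarrow> (nat \<Rightarrow> real) \<Rightarrow> nat set" where
  "A_set I H0 q w =
     {j \<in> H0. ereal (w j) \<le> - knockoff_threshold I q (w(j := \<bar>w j\<bar>))}"

definition I_q ::
  "'a measure \<Rightarrow> nat set \<Rightarrow> nat set \<Rightarrow> (nat \<Rightarrow> 'a \<Rightarrow> real) \<Rightarrow> real \<Rightarrow> ennreal" where
  "I_q M I H0 W q =
     (\<integral>\<^sup>+\<omega>. (let A = A_set I H0 q (\<lambda>i. W i \<omega>) in
        if A = {} then 0 else (\<Sum>j\<in>A. Omega M I W j \<omega>) / of_nat (card A)) \<partial>M)"

definition M_minus ::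
  "'a measure \<Rightarrow> nat set \<Rightarrow> nat set \<Rightarrow> (nat \<Rightarrow> 'a \<Rightarrow> real) \<Rightarrow> ennreal" where
  "M_minus M I H0 W =
     (\<integral>\<^sup>+\<omega>. max 1 (Max (insert 0 ((\<lambda>j. Omega M I W j \<omega>) ` {j \<in> H0. W j \<omega> < 0}))) \<partial>M)"

end

theory Submission
  imports Defs
begin

text \<open>
  For a null \<open>j\<close> let \<open>w(j := \<bar>w j\<bar>)\<close> be the scores with the sign of \<open>j\<close> erased. A rejected null
  is unaffected by the erasure, so the stopping rule gives
  \<open>fdp \<le> q * (\<Sum>j | w j > 0. loo_weight j)\<close>, where the weight of \<open>j\<close> does not depend on the sign
  of \<open>w j\<close>. The thresholds obtained by erasing the sign of any \<open>j \<in> A_set\<close> all agree, whence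
  the same sum over \<open>w j < 0\<close> has at most \<open>card A_set\<close> nonzero terms, each at most
  \<open>1 / card A_set\<close>. Conditioning on everything but the sign of \<open>W j\<close> exchanges \<open>W j > 0\<close> for
  \<open>W j < 0\<close> at the cost of the factor \<open>Omega j\<close>, which yields the two likelihood ratio bounds.
  For fair signs, the exchange is exact after averaging over all sign vectors. So the conditional
  expectation of the false discovery proportion exceeds \<open>q\<close> by at most the total variation
  distance to fair signs, which Pinsker's inequality bounds.
\<close>

section \<open>Leave-one-out weights\<close>

text \<open>Negative counterpart of \<open>rejections\<close>: the count behind
  \<open>N_minus\<close> taken at the threshold itself. An infinite threshold makes it empty, since
  no real score lies below \<open>-\<infinity>\<close>.\<close>

definition mirror_set :: "nat set \<Rightarrow> real \<Rightarrow> (nat \<Rightarrow> real) \<Rightarrow> nat set" where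
  "mirror_set I q w = {i \<in> I. ereal (w i) \<le> - knockoff_threshold I q w}"

definition fdp :: "nat set \<Rightarrow> nat set \<Rightarrow> real \<Rightarrow> (nat \<Rightarrow> real) \<Rightarrow> real" where
  "fdp I H0 q w = real (card (rejections I q w \<inter> H0)) / max (real (card (rejections I q w))) 1"

text \<open>Reads \<open>w j\<close> only through its absolute value, so it is a legitimate factor
  when conditioning on everything except the sign of score \<open>j\<close>. The \<open>1 +\<close>
  is the one in the knockoff+ numerator.\<close>

definition loo_weight :: "nat set \<Rightarrow> real \<Rightarrow> nat \<Rightarrow> (nat \<Rightarrow> real) \<Rightarrow> real" where
  "loo_weight I q j w =
     (if j \<in> rejections I q (w(j := \<bar>w j\<bar>))
      then 1 / (1 + real (card (mirror_set I q (w(j := \<bar>w j\<bar>))))) else 0)"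

lemma loo_weight_nonneg [simp]: "0 \<le> loo_weight I q j w"
  and loo_weight_le_1 [simp]: "loo_weight I q j w \<le> 1"
  by (auto simp: loo_weight_def)

lemma loo_weight_cong:
  "w(j := \<bar>w j\<bar>) = v(j := \<bar>v j\<bar>) \<Longrightarrow> loo_weight I q j w = loo_weight I q j v"
  by (simp add: loo_weight_def)

lemma fdp_nonneg [simp]: "0 \<le> fdp I H0 q w"
  by (simp add: fdp_def)

lemma fdp_le_1 [simp]:
  assumes "finite I" shows "fdp I H0 q w \<le> 1"
proof -
  have "card (rejections I q w \<inter> H0) \<le> card (rejections I q w)"
    using assms by (intro card_mono) (auto simp: rejections_def)
  then show ?thesis by (auto simp: fdp_def divide_le_eq_1)
qed

section \<open>The threshold and its rejections\<close>

lemma finite_admissible_thresholds: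
  assumes "finite I" shows "finite (admissible_thresholds I q w)"
proof (rule finite_subset)
  show "admissible_thresholds I q w \<subseteq> (\<lambda>i. \<bar>w i\<bar>) ` I"
    by (auto simp: admissible_thresholds_def)
qed (use assms in simp)

lemma admissible_thresholds_pos: "t \<in> admissible_thresholds I q w \<Longrightarrow> 0 < t"
  by (auto simp: admissible_thresholds_def)

text \<open>A minimum over finitely many candidates lies below \<open>x\<close> iff some candidate
  does. This form absorbs the infinite case and later yields measurability.\<close>

lemma knockoff_threshold_le_iff:
  assumes "finite I"
  shows "knockoff_threshold I q w \<le> ereal x \<longleftrightarrow> (\<exists>t\<in>admissible_thresholds I q w. t \<le> x)"
  using finite_admissible_thresholds[OF assms, of q w]
  by (auto simp: knockoff_threshold_def Min_le_iff)

lemma knockoff_threshold_pos: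
  assumes "finite I" shows "0 < knockoff_threshold I q w"
  using finite_admissible_thresholds[OF assms, of q w]
  by (auto simp: knockoff_threshold_def admissible_thresholds_pos)

lemma le_minus_threshold_iff:
  "ereal x \<le> - knockoff_threshold I q w \<longleftrightarrow> knockoff_threshold I q w \<le> ereal (- x)"
  by (metis ereal_minus_le_minus ereal_uminus_uminus uminus_ereal.simps(1))

lemma rejections_pos:
  assumes "finite I" "j \<in> rejections I q w" shows "0 < w j"
  using knockoff_threshold_pos[OF assms(1), of q w] assms(2)
  by (auto simp: rejections_def) (metis ereal_less(2) order_less_le_trans)

text \<open>A rejection forces a finite threshold, which is a minimum attained in the admissible set
  and therefore satisfies the stopping rule, here multiplied out.\<close>

lemma card_mirror_set_le:
  assumes "finite I" "rejections I q w \<noteq> {}"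
  shows "1 + real (card (mirror_set I q w)) \<le> q * max (real (card (rejections I q w))) 1"
proof -
  let ?T = "admissible_thresholds I q w"
  have ne: "?T \<noteq> {}"
    using assms(2) by (auto simp: rejections_def knockoff_threshold_def)
  have t: "knockoff_threshold I q w = ereal (Min ?T)"
    using ne by (simp add: knockoff_threshold_def)
  have "Min ?T \<in> ?T"
    using ne finite_admissible_thresholds[OF assms(1)] by simp
  then have "(1 + real (N_minus I w (Min ?T))) / max (real (N_plus I w (Min ?T))) 1 \<le> q"
    unfolding admissible_thresholds_def by blast
  moreover have "N_minus I w (Min ?T) = card (mirror_set I q w)"
    "N_plus I w (Min ?T) = card (rejections I q w)"
    by (simp_all add: N_minus_def N_plus_def mirror_set_def rejections_def t)
  ultimately show ?thesis by (simp add: divide_le_eq mult.commute)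
qed

lemma fdp_le:
  assumes "finite I" "H0 \<subseteq> I" "0 \<le> q"
  shows "fdp I H0 q w \<le> q * (\<Sum>j\<in>H0. if 0 < w j then loo_weight I q j w else 0)"
proof (cases "rejections I q w = {}")
  case True
  then show ?thesis using assms by (auto simp: fdp_def intro!: mult_nonneg_nonneg sum_nonneg)
next
  case False
  let ?R = "rejections I q w" and ?m = "1 + real (card (mirror_set I q w))"
  have fin: "finite H0" using assms finite_subset by blast
  have "fdp I H0 q w = real (card (?R \<inter> H0)) * (1 / max (real (card ?R)) 1)"
    by (simp add: fdp_def)
  \<comment> \<open>The stopping rule bounds the reciprocal of the number of rejections by
    \<open>q\<close> over one plus the mirror count.\<close>
  also have "\<dots> \<le> real (card (?R \<inter> H0)) * (q / ?m)"
    using card_mirror_set_le[OF assms(1) False]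
    by (intro mult_left_mono) (auto simp: field_simps)
  also have "\<dots> = q * (\<Sum>j\<in>?R \<inter> H0. 1 / ?m)"
    by simp
  also have "(\<Sum>j\<in>?R \<inter> H0. 1 / ?m) = (\<Sum>j\<in>?R \<inter> H0. if 0 < w j then loo_weight I q j w else 0)"
  proof (intro sum.cong refl)
    \<comment> \<open>A rejected score is positive, so erasing its sign changes nothing and its
      weight is computed from \<open>w\<close> itself.\<close>
    fix j assume j: "j \<in> ?R \<inter> H0"
    then have "0 < w j" using rejections_pos[OF assms(1)] by auto
    moreover from this have "w(j := \<bar>w j\<bar>) = w" by auto
    ultimately show "1 / ?m = (if 0 < w j then loo_weight I q j w else 0)"
      using j by (simp add: loo_weight_def)
  qed
  also have "\<dots> \<le> (\<Sum>j\<in>H0. if 0 < w j then loo_weight I q j w else 0)"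
    using fin by (intro sum_mono2) auto
  finally show ?thesis using assms by (simp add: mult_left_mono)
qed

text \<open>The threshold is positive, so lying below its negative forces \<open>w j < 0\<close>,
  and then \<open>\<bar>w j\<bar> = - w j\<close> passes the erased threshold. Hence
  \<open>A_set\<close> consists of the negative nulls with nonzero weight.\<close>

lemma A_set_iff:
  assumes "finite I" "H0 \<subseteq> I"
  shows "j \<in> A_set I H0 q w \<longleftrightarrow> j \<in> H0 \<and> w j < 0 \<and> j \<in> rejections I q (w(j := \<bar>w j\<bar>))"
proof -
  let ?t = "knockoff_threshold I q (w(j := \<bar>w j\<bar>))"
  have "w j < 0" if "?t \<le> ereal (- w j)"
    using order_less_le_trans[OF knockoff_threshold_pos[OF assms(1)] that] by simp
  then show ?thesis
    using assms(2) by (auto simp: A_set_def rejections_def le_minus_threshold_iff)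
qed

lemma admissible_thresholds_swap:
  assumes I: "finite I" "j \<in> I" "k \<in> I" and neg: "w j < 0" "w k < 0"
    and t: "t \<in> admissible_thresholds I q (w(j := \<bar>w j\<bar>))" "t \<le> - w j" "t \<le> - w k"
  shows "t \<in> admissible_thresholds I q (w(k := \<bar>w k\<bar>))"
proof -
  have pos: "0 < t" using t(1) by (rule admissible_thresholds_pos)
  \<comment> \<open>Neither count depends on which index \<open>i\<close> is raised. The
    natural-number subtraction is genuine, because \<open>i\<close> itself is counted in
    \<open>N_minus I w t\<close>.\<close>
  have minus: "N_minus I (w(i := \<bar>w i\<bar>)) t = N_minus I w t - 1"
    and plus: "N_plus I (w(i := \<bar>w i\<bar>)) t = N_plus I w t + 1"
    if i: "i \<in> I" "w i < 0" "t \<le> - w i" for i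
  proof -
    have "{l \<in> I. (w(i := \<bar>w i\<bar>)) l \<le> - t} = {l \<in> I. w l \<le> - t} - {i}"
      using i pos by auto
    then show "N_minus I (w(i := \<bar>w i\<bar>)) t = N_minus I w t - 1"
      unfolding N_minus_def using i I by (simp add: card_Diff_singleton)
    have "{l \<in> I. (w(i := \<bar>w i\<bar>)) l \<ge> t} = insert i {l \<in> I. w l \<ge> t}"
      using i pos by auto
    moreover have "i \<notin> {l \<in> I. w l \<ge> t}" using i pos by auto
    ultimately show "N_plus I (w(i := \<bar>w i\<bar>)) t = N_plus I w t + 1"
      unfolding N_plus_def using I by simp
  qed
  have abs_upd: "\<bar>(w(i := \<bar>w i\<bar>)) l\<bar> = \<bar>w l\<bar>" for i l by simp
  \<comment> \<open>Erasing a sign leaves the set of absolute values unchanged, so after rewriting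
    the counts the admissibility conditions for \<open>j\<close> and \<open>k\<close> coincide
    literally.\<close>
  show ?thesis
    using t(1) I neg t(2,3)
    by (simp only: admissible_thresholds_def mem_Collect_eq abs_upd minus plus)
qed

text \<open>Raising a strongly negative null score to its absolute value moves one index from the
  negative to the positive count, whichever index it is; so a threshold admissible after
  raising one member of \<open>A_set\<close> stays admissible after raising another instead.\<close>

lemma A_set_threshold_eq:
  assumes "finite I" "H0 \<subseteq> I" "j \<in> A_set I H0 q w" "k \<in> A_set I H0 q w"
  shows "knockoff_threshold I q (w(j := \<bar>w j\<bar>)) = knockoff_threshold I q (w(k := \<bar>w k\<bar>))"
proof -
  let ?t = "\<lambda>j. knockoff_threshold I q (w(j := \<bar>w j\<bar>))"
  \<comment> \<open>Start from the smaller threshold: it lies below both \<open>- w j\<close> and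
    \<open>- w k\<close>, so it stays admissible when the roles are swapped, which gives the reverse
    inequality.\<close>
  have le: "?t k \<le> ?t j"
    if jk: "j \<in> A_set I H0 q w" "k \<in> A_set I H0 q w" and *: "?t j \<le> ?t k" for j k
  proof -
    have I: "j \<in> I" "k \<in> I" "w j < 0" "w k < 0"
      using jk assms(2) by (auto simp: A_set_iff[OF assms(1,2)])
    have tk: "?t k \<le> ereal (- w k)" and tj: "?t j \<le> ereal (- w j)"
      using jk by (auto simp: A_set_def le_minus_threshold_iff)
    from tj have ne: "admissible_thresholds I q (w(j := \<bar>w j\<bar>)) \<noteq> {}"
      by (auto simp: knockoff_threshold_def)
    define t where "t = Min (admissible_thresholds I q (w(j := \<bar>w j\<bar>)))"
    have t: "?t j = ereal t" using ne by (simp add: knockoff_threshold_def t_def)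
    have "t \<in> admissible_thresholds I q (w(j := \<bar>w j\<bar>))"
      unfolding t_def using ne finite_admissible_thresholds[OF assms(1)] by simp
    moreover have "t \<le> - w j" "t \<le> - w k" using tj order_trans[OF * tk] t by simp_all
    ultimately have "t \<in> admissible_thresholds I q (w(k := \<bar>w k\<bar>))"
      by (intro admissible_thresholds_swap[OF assms(1) I])
    then show ?thesis
      unfolding t by (auto simp: knockoff_threshold_le_iff[OF assms(1)])
  qed
  show ?thesis using le[OF assms(3,4)] le[OF assms(4,3)] by (meson linear order_antisym)
qed

text \<open>The common threshold puts every other member of \<open>A_set\<close> into the mirror set
  obtained by raising \<open>j\<close>. The index \<open>j\<close> itself drops out, and the
  \<open>1 +\<close> in the weight makes up for it.\<close>

lemma loo_weight_le_inverse_card_A_set: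
  assumes "finite I" "H0 \<subseteq> I" "j \<in> A_set I H0 q w"
  shows "loo_weight I q j w \<le> 1 / real (card (A_set I H0 q w))"
proof -
  let ?A = "A_set I H0 q w" and ?B = "mirror_set I q (w(j := \<bar>w j\<bar>))"
  have fin: "finite ?A" "finite ?B"
    using assms(1,2) by (auto simp: A_set_def mirror_set_def dest: finite_subset)
  have "?A - {j} \<subseteq> ?B"
  proof
    fix k assume k: "k \<in> ?A - {j}"
    then have "ereal (w k) \<le> - knockoff_threshold I q (w(j := \<bar>w j\<bar>))"
      using A_set_threshold_eq[OF assms, of k] by (auto simp: A_set_def)
    then show "k \<in> ?B" using k assms(2) by (auto simp: mirror_set_def A_set_def)
  qed
  then have "card ?A - 1 \<le> card ?B"
    using assms(3) fin by (metis card_Diff_singleton card_mono)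
  then have "real (card ?A) \<le> 1 + real (card ?B)" by linarith
  moreover have "0 < card ?A" using assms(3) fin by (auto simp: card_gt_0_iff)
  ultimately show ?thesis by (auto simp: loo_weight_def frac_le)
qed

lemma negative_loo_weight_sum_le:
  assumes "finite I" "H0 \<subseteq> I"
  shows "(\<Sum>j\<in>H0. if w j < 0 then loo_weight I q j w else 0) \<le> 1"
proof -
  let ?A = "A_set I H0 q w"
  have fin: "finite H0" using assms finite_subset by blast
  have A: "?A \<subseteq> H0" by (auto simp: A_set_def)
  have "(\<Sum>j\<in>H0. if w j < 0 then loo_weight I q j w else 0) = (\<Sum>j\<in>?A. loo_weight I q j w)"
    using fin A by (intro sum.mono_neutral_cong_right) (auto simp: A_set_iff[OF assms] loo_weight_def)
  also have "\<dots> \<le> (\<Sum>j\<in>?A. 1 / real (card ?A))"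
    by (intro sum_mono loo_weight_le_inverse_card_A_set assms)
  \<comment> \<open>The sum is 1 for a nonempty \<open>A_set\<close> and 0 for an empty one.\<close>
  also have "\<dots> \<le> 1" by simp
  finally show ?thesis .
qed

section \<open>Averaging over fair sign flips\<close>

definition flip_sign :: "nat \<Rightarrow> (nat \<Rightarrow> real) \<Rightarrow> nat \<Rightarrow> real" where
  "flip_sign j s = s(j := - s j)"

text \<open>For fixed \<open>s\<close>, the null scores enter through their magnitudes only, so the
  result carries no information about the realised null signs.\<close>

definition with_signs :: "nat set \<Rightarrow> (nat \<Rightarrow> real) \<Rightarrow> (nat \<Rightarrow> real) \<Rightarrow> nat \<Rightarrow> real" where
  "with_signs H0 w s i = (if i \<in> H0 then s i * \<bar>w i\<bar> else w i)"

text \<open>FDR control under fair signs, for fixed magnitudes. Flipping coordinate \<open>j\<close>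
  is an involution of the sign vectors that exchanges positive and negative values of score
  \<open>j\<close> and preserves its weight; afterwards the negative weights sum to at most 1 for
  each sign vector.\<close>

lemma sum_fdp_with_signs_le:
  assumes "finite I" "H0 \<subseteq> I" "0 \<le> q"
  shows "(\<Sum>s\<in>(\<Pi>\<^sub>E j\<in>H0. {-1, 1}). fdp I H0 q (with_signs H0 w s)) \<le> q * 2 ^ card H0"
proof -
  let ?S = "\<Pi>\<^sub>E j\<in>H0. {-1, 1::real}"
  let ?w = "with_signs H0 w"
  have fin: "finite H0" using assms finite_subset by blast
  have flip: "(\<Sum>s\<in>?S. if 0 < ?w s j then loo_weight I q j (?w s) else 0)
      = (\<Sum>s\<in>?S. if ?w s j < 0 then loo_weight I q j (?w s) else 0)" if j: "j \<in> H0" for j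
  proof (rule sum.reindex_bij_witness[of _ "flip_sign j" "flip_sign j"])
    fix s assume s: "s \<in> ?S"
    show "flip_sign j (flip_sign j s) = s" "flip_sign j (flip_sign j s) = s"
      by (simp_all add: flip_sign_def)
    show "flip_sign j s \<in> ?S" "flip_sign j s \<in> ?S"
      using s j by (auto simp: flip_sign_def PiE_iff extensional_def)
    have "s j = 1 \<or> s j = - 1" using s j by (auto simp: PiE_iff)
    then have "(?w s)(j := \<bar>?w s j\<bar>) = (?w (flip_sign j s))(j := \<bar>?w (flip_sign j s) j\<bar>)"
      using j by (auto simp: with_signs_def flip_sign_def)
    then have "loo_weight I q j (?w s) = loo_weight I q j (?w (flip_sign j s))"
      by (rule loo_weight_cong)
    moreover have "?w (flip_sign j s) j = - ?w s j"
      using j by (simp add: with_signs_def flip_sign_def)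
    ultimately show "(if ?w (flip_sign j s) j < 0 then loo_weight I q j (?w (flip_sign j s)) else 0)
        = (if 0 < ?w s j then loo_weight I q j (?w s) else 0)" by simp
  qed
  have "(\<Sum>s\<in>?S. fdp I H0 q (?w s))
      \<le> (\<Sum>s\<in>?S. q * (\<Sum>j\<in>H0. if 0 < ?w s j then loo_weight I q j (?w s) else 0))"
    by (intro sum_mono fdp_le assms)
  also have "\<dots> = q * (\<Sum>j\<in>H0. \<Sum>s\<in>?S. if 0 < ?w s j then loo_weight I q j (?w s) else 0)"
    by (subst sum.swap) (simp add: sum_distrib_left)
  also have "\<dots> = q * (\<Sum>j\<in>H0. \<Sum>s\<in>?S. if ?w s j < 0 then loo_weight I q j (?w s) else 0)"
    by (simp add: flip)
  also have "\<dots> = q * (\<Sum>s\<in>?S. \<Sum>j\<in>H0. if ?w s j < 0 then loo_weight I q j (?w s) else 0)"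
    by (subst sum.swap) simp
  also have "\<dots> \<le> q * (\<Sum>s\<in>?S. 1)"
    by (intro mult_left_mono sum_mono negative_loo_weight_sum_le assms)
  also have "(\<Sum>s\<in>?S. 1) = (2::real) ^ card H0"
    using fin by (simp add: card_PiE)
  finally show ?thesis .
qed

section \<open>Divergences of finitely supported laws\<close>

lemma ln_lower_bound_ge_1:
  fixes x :: real assumes "1 \<le> x" shows "2 * (x - 1) / (x + 1) \<le> ln x"
proof -
  let ?h = "\<lambda>x::real. ln x - 2 * (x - 1) / (x + 1)"
  have "?h 1 \<le> ?h x"
  proof (rule DERIV_nonneg_imp_nondecreasing[OF assms])
    fix y :: real assume y: "1 \<le> y" "y \<le> x"
    have "(?h has_real_derivative 1 / y - (2 * (y + 1) - 2 * (y - 1)) / ((y + 1) * (y + 1))) (at y)"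
      using y by (auto intro!: derivative_eq_intros)
    \<comment> \<open>The derivative is a square over a positive quantity, and the difference
      vanishes at 1.\<close>
    moreover have "1 / y - (2 * (y + 1) - 2 * (y - 1)) / ((y + 1) * (y + 1)) = (y - 1)\<^sup>2 / (y * (y + 1)\<^sup>2)"
      using y by (simp add: divide_simps power2_eq_square) (simp add: algebra_simps)
    moreover have "0 \<le> (y - 1)\<^sup>2 / (y * (y + 1)\<^sup>2)" using y by simp
    ultimately show "\<exists>d. (?h has_real_derivative d) (at y) \<and> 0 \<le> d" by metis
  qed
  then show ?thesis by simp
qed

text \<open>Both sides change sign under \<open>x\<close> to \<open>1 / x\<close>, which reduces the
  claim to arguments at least 1.\<close>

lemma ln_upper_bound_le_1:
  fixes x :: real assumes "0 < x" "x \<le> 1" shows "ln x \<le> 2 * (x - 1) / (x + 1)"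
proof -
  have "2 * (1 / x - 1) / (1 / x + 1) \<le> ln (1 / x)"
    using assms by (intro ln_lower_bound_ge_1) simp
  moreover have "2 * (1 / x - 1) / (1 / x + 1) = - (2 * (x - 1) / (x + 1))"
    using assms by (simp add: divide_simps)
  ultimately show ?thesis using assms by (simp add: ln_div)
qed

text \<open>The difference of the two sides vanishes at 1 and has its minimum there: the two
  logarithm bounds determine the sign of its derivative on either side.\<close>

lemma quadratic_le_xlnx:
  fixes x :: real assumes "0 < x"
  shows "3 * (x - 1)\<^sup>2 \<le> (2 * x + 4) * (x * ln x - x + 1)"
proof -
  let ?g = "\<lambda>x::real. (2 * x + 4) * (x * ln x - x + 1) - 3 * (x - 1)\<^sup>2"
  have deriv: "(?g has_real_derivative (4 * y + 4) * ln y - 8 * (y - 1)) (at y)" if "0 < y" for y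
    using that by (auto intro!: derivative_eq_intros simp: field_simps power2_eq_square)
  have "?g 1 \<le> ?g x"
  proof (cases "1 \<le> x")
    case True
    show ?thesis
    proof (rule DERIV_nonneg_imp_nondecreasing[OF True])
      fix y :: real assume y: "1 \<le> y" "y \<le> x"
      have "0 \<le> (4 * y + 4) * ln y - 8 * (y - 1)"
        using ln_lower_bound_ge_1[OF y(1)] y by (simp add: field_simps)
      then show "\<exists>d. (?g has_real_derivative d) (at y) \<and> 0 \<le> d"
        using deriv[of y] y by (intro exI conjI) auto
    qed
  next
    case False
    then have le: "x \<le> 1" by simp
    show ?thesis
    proof (rule DERIV_nonpos_imp_nonincreasing[OF le])
      fix y :: real assume y: "x \<le> y" "y \<le> 1"
      then have "0 < y" using assms by simp
      have "(4 * y + 4) * ln y - 8 * (y - 1) \<le> 0"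
        using ln_upper_bound_le_1[OF \<open>0 < y\<close> y(2)] \<open>0 < y\<close> by (simp add: field_simps)
      then show "\<exists>d. (?g has_real_derivative d) (at y) \<and> d \<le> 0"
        using deriv[OF \<open>0 < y\<close>] by blast
    qed
  qed
  then show ?thesis by simp
qed

text \<open>Applied at the likelihood ratio, the previous inequality bounds the squared difference of the
  masses by a product, and Cauchy--Schwarz sums it up.\<close>

lemma pinsker_finite:
  fixes p r :: "'b \<Rightarrow> real"
  assumes S: "finite S" "A \<subseteq> S"
    and p: "\<And>s. s \<in> S \<Longrightarrow> 0 \<le> p s" "(\<Sum>s\<in>S. p s) = 1"
    and r: "\<And>s. s \<in> S \<Longrightarrow> 0 \<le> r s" "(\<Sum>s\<in>S. r s) = 1"
    and ac: "\<And>s. s \<in> S \<Longrightarrow> r s = 0 \<Longrightarrow> p s = 0"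
  shows "\<bar>(\<Sum>s\<in>A. p s) - (\<Sum>s\<in>A. r s)\<bar> \<le> sqrt ((\<Sum>s\<in>S. p s * ln (p s / r s)) / 2)"
proof -
  \<comment> \<open>The added terms \<open>- p s + r s\<close> sum to zero, so \<open>k\<close>
    still sums to the divergence but is nonnegative termwise. The factor \<open>c\<close> sums to 2
    + 4 = 6.\<close>
  define k where "k s = p s * ln (p s / r s) - p s + r s" for s
  define c where "c s = 2 * p s + 4 * r s" for s
  have key: "3 * (p s - r s)\<^sup>2 \<le> c s * k s \<and> 0 \<le> k s" if s: "s \<in> S" for s
  proof (cases "p s = 0 \<or> r s = 0")
    case True
    then show ?thesis using p(1)[OF s] r(1)[OF s] ac[OF s]
      by (auto simp: c_def k_def power2_eq_square)
  next
    case False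
    then have pos: "0 < p s" "0 < r s" using p(1)[OF s] r(1)[OF s] by auto
    have "3 * (p s - r s)\<^sup>2 = (r s)\<^sup>2 * (3 * (p s / r s - 1)\<^sup>2)"
      using pos by (simp add: field_simps power2_eq_square)
    also have "\<dots> \<le> (r s)\<^sup>2 * ((2 * (p s / r s) + 4) * (p s / r s * ln (p s / r s) - p s / r s + 1))"
      using pos by (intro mult_left_mono quadratic_le_xlnx) auto
    also have "\<dots> = c s * k s"
      using pos by (simp add: c_def k_def field_simps power2_eq_square)
    finally have 1: "3 * (p s - r s)\<^sup>2 \<le> c s * k s" .
    have "0 < c s" using pos by (simp add: c_def)
    moreover have "0 \<le> c s * k s" using 1 by (meson order_trans zero_le_mult_iff zero_le_numeral zero_le_power2)
    ultimately have "0 \<le> k s" by (simp add: zero_le_mult_iff)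
    with 1 show ?thesis by simp
  qed
  have c: "0 \<le> c s" if "s \<in> S" for s using p(1)[OF that] r(1)[OF that] by (simp add: c_def)
  let ?D = "\<Sum>s\<in>S. \<bar>p s - r s\<bar>" and ?K = "\<Sum>s\<in>S. p s * ln (p s / r s)"
  have sums: "(\<Sum>s\<in>S. c s) = 6" "(\<Sum>s\<in>S. k s) = ?K"
    using p(2) r(2) by (simp_all add: c_def k_def sum.distrib sum_subtractf flip: sum_distrib_left)
  have "sqrt 3 * ?D = (\<Sum>s\<in>S. sqrt (3 * (p s - r s)\<^sup>2))"
    by (simp add: real_sqrt_mult sum_distrib_left)
  also have "\<dots> \<le> (\<Sum>s\<in>S. sqrt (c s) * sqrt (k s))"
    unfolding real_sqrt_mult[symmetric] using key by (intro sum_mono real_sqrt_le_mono) auto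
  \<comment> \<open>Cauchy--Schwarz gives \<open>3 * ?D\<^sup>2 \<le> 6 * ?K\<close>, where
    \<open>?D\<close> is the full L1 distance.\<close>
  finally have "(sqrt 3 * ?D)\<^sup>2 \<le> (\<Sum>s\<in>S. sqrt (c s) * sqrt (k s))\<^sup>2"
    by (intro power_mono) (auto intro!: mult_nonneg_nonneg sum_nonneg)
  also have "\<dots> \<le> (\<Sum>s\<in>S. (sqrt (c s))\<^sup>2) * (\<Sum>s\<in>S. (sqrt (k s))\<^sup>2)"
    by (rule Cauchy_Schwarz_ineq_sum)
  also have "\<dots> = 6 * ?K"
    using key c sums by simp
  finally have D: "?D\<^sup>2 \<le> 2 * ?K" by (simp add: power_mult_distrib)
  \<comment> \<open>Both laws have mass one, so the deviation on the complement is the opposite one.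
    Bounding it on \<open>A\<close> and on \<open>S - A\<close> gains the factor 2 over the L1
    distance.\<close>
  have diff: "(\<Sum>s\<in>A. p s) - (\<Sum>s\<in>A. r s) = - ((\<Sum>s\<in>S - A. p s) - (\<Sum>s\<in>S - A. r s))"
    using sum.subset_diff[OF S(2,1), of p] sum.subset_diff[OF S(2,1), of r] p(2) r(2) by simp
  let ?x = "\<bar>(\<Sum>s\<in>A. p s) - (\<Sum>s\<in>A. r s)\<bar>"
  have "?x \<le> (\<Sum>s\<in>A. \<bar>p s - r s\<bar>)"
    by (simp flip: sum_subtractf add: sum_abs)
  moreover have "?x \<le> (\<Sum>s\<in>S - A. \<bar>p s - r s\<bar>)"
    unfolding diff abs_minus_cancel by (simp flip: sum_subtractf add: sum_abs)
  moreover have "?D = (\<Sum>s\<in>S - A. \<bar>p s - r s\<bar>) + (\<Sum>s\<in>A. \<bar>p s - r s\<bar>)"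
    by (rule sum.subset_diff[OF S(2,1)])
  ultimately have "2 * ?x \<le> ?D" by simp
  then have "(2 * ?x)\<^sup>2 \<le> ?D\<^sup>2" by (intro power_mono) auto
  with D have "?x\<^sup>2 \<le> ?K / 2" by (simp add: power_mult_distrib)
  then show ?thesis by (simp add: real_le_rsqrt)
qed

text \<open>The second branch records the default value: without absolute continuity
  \<open>RN_deriv\<close> is the zero function, and \<open>ln 0 = 0\<close>. A formula valid in all
  cases lets measurability in the outcome be read off later.\<close>

lemma KL_divergence_point_measure:
  fixes p r :: "'b \<Rightarrow> real"
  assumes S: "finite S" and p: "\<And>s. s \<in> S \<Longrightarrow> 0 \<le> p s" and r: "\<And>s. s \<in> S \<Longrightarrow> 0 \<le> r s"
  shows "KL_divergence (exp 1) (point_measure S (\<lambda>s. ennreal (r s))) (point_measure S (\<lambda>s. ennreal (p s)))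
     = (if \<forall>s\<in>S. r s = 0 \<longrightarrow> p s = 0 then \<Sum>s\<in>S. p s * ln (p s / r s) else 0)"
proof (cases "\<forall>s\<in>S. r s = 0 \<longrightarrow> p s = 0")
  case True
  interpret sigma_finite_measure "count_space S"
    using S by (intro sigma_finite_measure_count_space_finite)
  have "KL_divergence (exp 1) (point_measure S (\<lambda>s. ennreal (r s))) (point_measure S (\<lambda>s. ennreal (p s)))
     = (\<integral>s. p s * log (exp 1) (p s / r s) \<partial>count_space S)"
    unfolding point_measure_def using p r True
    by (intro KL_density_density) (auto simp: AE_count_space)
  then show ?thesis using True S by (simp add: lebesgue_integral_count_space_finite log_def)
next
  case False
  then obtain s where s: "s \<in> S" "r s = 0" "p s \<noteq> 0" by auto
  let ?P = "point_measure S (\<lambda>s. ennreal (p s))" and ?R = "point_measure S (\<lambda>s. ennreal (r s))"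
  have "\<not> (\<exists>f. f \<in> borel_measurable ?R \<and> density ?R f = ?P)"
  proof
    \<comment> \<open>A density would make the reference-null point \<open>s\<close> null for
      \<open>p\<close> as well.\<close>
    assume "\<exists>f. f \<in> borel_measurable ?R \<and> density ?R f = ?P"
    then obtain f where f: "f \<in> borel_measurable ?R" "density ?R f = ?P" by blast
    have "{s} \<in> null_sets ?R" using s by (simp add: null_sets_point_measure_iff)
    then have "{s} \<in> null_sets (density ?R f)"
      using f(1) absolutely_continuousI_density absolutely_continuous_def by blast
    then show False using s p[OF s(1)] by (simp add: f(2) null_sets_point_measure_iff)
  qed
  then have "RN_deriv ?R ?P = (\<lambda>_. 0)"
    unfolding RN_deriv_def by meson
  then have "KL_divergence (exp 1) ?R ?P = 0"
    by (simp add: KL_divergence_def entropy_density_def comp_def log_def)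
  with False show ?thesis by auto
qed

lemma tv_dist_point_measure:
  assumes S: "finite S" and p: "\<And>s. s \<in> S \<Longrightarrow> 0 \<le> p s" and r: "\<And>s. s \<in> S \<Longrightarrow> 0 \<le> r s"
  shows "tv_dist (point_measure S (\<lambda>s. ennreal (p s))) (point_measure S (\<lambda>s. ennreal (r s)))
     = (SUP A\<in>Pow S. \<bar>(\<Sum>s\<in>A. p s) - (\<Sum>s\<in>A. r s)\<bar>)"
  unfolding tv_dist_def sets_point_measure
  using assms by (intro SUP_cong refl) (simp add: measure_point_measure_finite_if)

text \<open>Among functions with values in [0, 1], the difference of the two expectations is largest
  for the indicator of the set where \<open>p\<close> exceeds \<open>r\<close>.\<close>

lemma sum_le_tv_dist:
  assumes S: "finite S" and p: "\<And>s. s \<in> S \<Longrightarrow> 0 \<le> p s" and r: "\<And>s. s \<in> S \<Longrightarrow> 0 \<le> r s"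
    and f: "\<And>s. s \<in> S \<Longrightarrow> 0 \<le> f s" "\<And>s. s \<in> S \<Longrightarrow> f s \<le> 1"
  shows "(\<Sum>s\<in>S. f s * p s) \<le> (\<Sum>s\<in>S. f s * r s)
     + tv_dist (point_measure S (\<lambda>s. ennreal (p s))) (point_measure S (\<lambda>s. ennreal (r s)))"
proof -
  let ?A = "{s \<in> S. r s < p s}"
  have "(\<Sum>s\<in>S. f s * p s) - (\<Sum>s\<in>S. f s * r s) = (\<Sum>s\<in>S. f s * (p s - r s))"
    by (simp add: sum_subtractf right_diff_distrib)
  also have "\<dots> \<le> (\<Sum>s\<in>S. if s \<in> ?A then p s - r s else 0)"
    using f by (intro sum_mono) (auto simp: mult_left_le_one_le mult_nonneg_nonpos)
  also have "\<dots> = (\<Sum>s\<in>?A. p s - r s)"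
    using S by (intro sum.mono_neutral_cong_right) auto
  also have "\<dots> = (\<Sum>s\<in>?A. p s) - (\<Sum>s\<in>?A. r s)"
    by (rule sum_subtractf)
  also have "\<dots> \<le> \<bar>(\<Sum>s\<in>?A. p s) - (\<Sum>s\<in>?A. r s)\<bar>" by simp
  also have "\<dots> \<le> (SUP A\<in>Pow S. \<bar>(\<Sum>s\<in>A. p s) - (\<Sum>s\<in>A. r s)\<bar>)"
    using S by (intro cSUP_upper) auto
  finally show ?thesis by (simp add: tv_dist_point_measure[OF S p r])
qed

lemma fair_signs_eq_point_measure:
  assumes fin: "finite H0"
  shows "fair_signs H0 = point_measure (sign_vectors H0)
     (\<lambda>s. ennreal (\<Prod>j\<in>H0. if s j = 0 then 0 else 1 / 2))"
proof (rule measure_eqI)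
  let ?N = "uniform_measure (count_space {-1, 0, 1::real}) {-1, 1}"
  let ?r = "\<lambda>s::nat \<Rightarrow> real. (\<Prod>j\<in>H0. if s j = 0 then 0 else 1 / 2 :: real)"
  have S: "finite (sign_vectors H0)" using fin by (simp add: sign_vectors_def finite_PiE)
  show "sets (fair_signs H0) = sets (point_measure (sign_vectors H0) (\<lambda>s. ennreal (?r s)))"
    using fin by (simp add: sets_fair_signs sets_point_measure)
  have N: "prob_space ?N" by (intro prob_space_uniform_measure) auto
  interpret N: prob_space ?N by (rule N)
  interpret finite_product_prob_space "\<lambda>_. ?N" H0
    by unfold_locales (rule fin)
  fix A assume "A \<in> sets (fair_signs H0)"
  then have A: "A \<subseteq> sign_vectors H0" using fin by (simp add: sets_fair_signs)
  \<comment> \<open>A single sign vector is a box, so its mass factorises; finite additivity then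
    determines the measure.\<close>
  have sing: "measure (fair_signs H0) {s} = ?r s" if s: "s \<in> sign_vectors H0" for s
  proof -
    have "{s} = (\<Pi>\<^sub>E j\<in>H0. {s j})"
      using s by (subst PiE_singleton) (auto simp: sign_vectors_def PiE_iff)
    then have "measure (fair_signs H0) {s} = (\<Prod>j\<in>H0. measure ?N {s j})"
      unfolding fair_signs_def using s by (simp only:) (intro prob_times, auto simp: sign_vectors_def PiE_iff)
    also have "\<dots> = ?r s"
    proof (intro prod.cong refl)
      fix j assume "j \<in> H0"
      then have "s j \<in> {-1, 0, 1}" using s by (auto simp: sign_vectors_def PiE_iff)
      then show "measure ?N {s j} = (if s j = 0 then 0 else 1 / 2)"
        by (auto simp: measure_uniform_measure measure_count_space)
    qed
    finally show ?thesis .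
  qed
  interpret F: prob_space "fair_signs H0"
    unfolding fair_signs_def by (intro prob_space_PiM N)
  have finA: "finite A" using A S by (rule finite_subset)
  have "measure (fair_signs H0) A = (\<Sum>s\<in>A. measure (fair_signs H0) {s})"
    using A finA fin by (intro F.finite_measure_eq_sum_singleton) (auto simp: sets_fair_signs)
  also have "\<dots> = (\<Sum>s\<in>A. ?r s)" using A by (intro sum.cong) (auto simp: sing)
  finally show "emeasure (fair_signs H0) A = emeasure (point_measure (sign_vectors H0) (\<lambda>s. ennreal (?r s))) A"
    using A S by (simp add: F.emeasure_eq_measure emeasure_point_measure_finite sum_ennreal prod_nonneg)
qed

section \<open>Measurability and conditional probabilities\<close>

text \<open>Every candidate threshold is some \<open>\<bar>U k \<omega>\<bar>\<close>, so the
  comparison becomes a finite disjunction over \<open>k\<close> of conditions on counts. Taking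
  \<open>V\<close> to be a score or its negative covers rejections and mirror sets.\<close>

lemma measurable_threshold_le:
  assumes I: "finite I" and U[measurable]: "\<And>i. i \<in> I \<Longrightarrow> U i \<in> borel_measurable F"
    and V[measurable]: "V \<in> borel_measurable F"
  shows "Measurable.pred F (\<lambda>\<omega>. knockoff_threshold I q (\<lambda>i. U i \<omega>) \<le> ereal (V \<omega>))"
proof -
  have [measurable]: "Measurable.pred F (\<lambda>\<omega>. i \<in> I \<and> P \<omega>)" if "i \<in> I \<Longrightarrow> Measurable.pred F P" for i P
    using that by (cases "i \<in> I") auto
  have card[measurable]: "(\<lambda>\<omega>. card {i \<in> I. P i \<omega>}) \<in> measurable F (count_space UNIV)"
    if "\<And>i. i \<in> I \<Longrightarrow> Measurable.pred F (P i)" for P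
    using that by (intro measurable_card) (auto simp: pred_def)
  have eq: "knockoff_threshold I q (\<lambda>i. U i \<omega>) \<le> ereal (V \<omega>) \<longleftrightarrow>
     (\<exists>k\<in>I. 0 < \<bar>U k \<omega>\<bar> \<and> \<bar>U k \<omega>\<bar> \<le> V \<omega> \<and>
       (1 + real (card {i \<in> I. U i \<omega> \<le> - \<bar>U k \<omega>\<bar>})) / max (real (card {i \<in> I. \<bar>U k \<omega>\<bar> \<le> U i \<omega>})) 1 \<le> q)"
    for \<omega>
    by (auto simp: knockoff_threshold_le_iff[OF I] admissible_thresholds_def N_plus_def N_minus_def)
  show ?thesis
    unfolding eq
  proof (intro pred_intros_finite(4) I)
    fix k assume k[measurable]: "k \<in> I"
    have Uk[measurable]: "U k \<in> borel_measurable F" using U k by blast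
    have [measurable]: "(\<lambda>\<omega>. card {i \<in> I. U i \<omega> \<le> - \<bar>U k \<omega>\<bar>}) \<in> measurable F (count_space UNIV)"
       "(\<lambda>\<omega>. card {i \<in> I. \<bar>U k \<omega>\<bar> \<le> U i \<omega>}) \<in> measurable F (count_space UNIV)"
      by (intro card; measurable)+
    show "Measurable.pred F (\<lambda>\<omega>. 0 < \<bar>U k \<omega>\<bar> \<and> \<bar>U k \<omega>\<bar> \<le> V \<omega> \<and>
       (1 + real (card {i \<in> I. U i \<omega> \<le> - \<bar>U k \<omega>\<bar>})) / max (real (card {i \<in> I. \<bar>U k \<omega>\<bar> \<le> U i \<omega>})) 1 \<le> q)"
      by measurable
  qed
qed

lemma measurable_mem_rejections:
  assumes I: "finite I" and U: "\<And>i. i \<in> I \<Longrightarrow> U i \<in> borel_measurable F"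
  shows "Measurable.pred F (\<lambda>\<omega>. j \<in> rejections I q (\<lambda>i. U i \<omega>))"
  using measurable_threshold_le[OF I U, where V = "U j" and q = q] U
  by (cases "j \<in> I") (auto simp: rejections_def)

lemma measurable_mem_mirror_set:
  assumes I: "finite I" and U: "\<And>i. i \<in> I \<Longrightarrow> U i \<in> borel_measurable F"
  shows "Measurable.pred F (\<lambda>\<omega>. j \<in> mirror_set I q (\<lambda>i. U i \<omega>))"
  using measurable_threshold_le[OF I U, where V = "\<lambda>\<omega>. - U j \<omega>" and q = q] U
  by (cases "j \<in> I") (auto simp: mirror_set_def le_minus_threshold_iff)

lemma borel_measurable_fdp:
  assumes I: "finite I" and U: "\<And>i. i \<in> I \<Longrightarrow> U i \<in> borel_measurable F"
  shows "(\<lambda>\<omega>. fdp I H0 q (\<lambda>i. U i \<omega>)) \<in> borel_measurable F"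
proof -
  have R[measurable]: "Measurable.pred F (\<lambda>\<omega>. j \<in> rejections I q (\<lambda>i. U i \<omega>))" for j
    by (rule measurable_mem_rejections[OF assms])
  have [measurable]: "(\<lambda>\<omega>. card (rejections I q (\<lambda>i. U i \<omega>))) \<in> measurable F (count_space UNIV)"
    "(\<lambda>\<omega>. card (rejections I q (\<lambda>i. U i \<omega>) \<inter> H0)) \<in> measurable F (count_space UNIV)"
    by (auto intro!: measurable_card simp: pred_def[symmetric])
  show ?thesis unfolding fdp_def by measurable
qed

text \<open>The hypothesis on index \<open>j\<close> concerns the absolute value only, so the lemma
  applies to an algebra that does not see the sign of that score.\<close>

lemma borel_measurable_loo_weight:
  assumes I: "finite I" and j: "(\<lambda>\<omega>. \<bar>U j \<omega>\<bar>) \<in> borel_measurable F"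
    and U: "\<And>i. i \<in> I \<Longrightarrow> i \<noteq> j \<Longrightarrow> U i \<in> borel_measurable F"
  shows "(\<lambda>\<omega>. loo_weight I q j (\<lambda>i. U i \<omega>)) \<in> borel_measurable F"
proof -
  let ?V = "U(j := \<lambda>\<omega>. \<bar>U j \<omega>\<bar>)"
  have upd: "(\<lambda>i. U i \<omega>)(j := \<bar>U j \<omega>\<bar>) = (\<lambda>i. ?V i \<omega>)" for \<omega> by auto
  have V: "?V i \<in> borel_measurable F" if "i \<in> I" for i using j U that by auto
  have [measurable]: "Measurable.pred F (\<lambda>\<omega>. j \<in> rejections I q (\<lambda>i. ?V i \<omega>))"
    by (rule measurable_mem_rejections[OF I V])
  have mirror: "Measurable.pred F (\<lambda>\<omega>. k \<in> mirror_set I q (\<lambda>i. ?V i \<omega>))" for k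
    by (rule measurable_mem_mirror_set[OF I V])
  have [measurable]: "(\<lambda>\<omega>. card (mirror_set I q (\<lambda>i. ?V i \<omega>))) \<in> measurable F (count_space UNIV)"
    using mirror unfolding pred_def by (rule measurable_card)
  show ?thesis unfolding loo_weight_def upd by measurable
qed

section \<open>Generated algebras and conditional probabilities\<close>

lemma measurable_gen_algebra:
  assumes "X \<in> Xs" shows "X \<in> borel_measurable (gen_algebra M Xs)"
proof (rule measurableI)
  have sub: "{X -` B \<inter> space M |X B. X \<in> Xs \<and> B \<in> sets borel} \<subseteq> Pow (space M)" by auto
  fix B :: "real set" assume "B \<in> sets borel"
  then show "X -` B \<inter> space (gen_algebra M Xs) \<in> sets (gen_algebra M Xs)"
    using assms unfolding gen_algebra_def
    by (auto simp: space_measure_of[OF sub] sets_measure_of[OF sub] intro!: sigma_sets.Basic)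
qed simp

lemma cprob_measurable [measurable]: "cprob M F P \<in> borel_measurable F"
  by (simp add: cprob_def)

context prob_space
begin

lemma integral_mult_cprob:
  assumes F: "subalgebra M F" and Z: "Z \<in> borel_measurable F" "\<And>\<omega>. 0 \<le> Z \<omega>" "\<And>\<omega>. Z \<omega> \<le> 1"
    and P: "{\<omega> \<in> space M. P \<omega>} \<in> sets M"
  shows "integrable M (\<lambda>\<omega>. Z \<omega> * cprob M F P \<omega>)"
    and "(\<integral>\<omega>. Z \<omega> * cprob M F P \<omega> \<partial>M) = (\<integral>\<omega>. (if P \<omega> then Z \<omega> else 0) \<partial>M)"
proof -
  interpret finite_measure_subalgebra M F by unfold_locales fact
  have [measurable]: "Z \<in> borel_measurable M" using measurable_from_subalg[OF F Z(1)] .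
  have int: "integrable M (\<lambda>\<omega>. Z \<omega> * indicator {\<omega> \<in> space M. P \<omega>} \<omega>)"
    using Z P by (intro integrable_const_bound[where B = 1]) (auto simp: indicator_def)
  show "integrable M (\<lambda>\<omega>. Z \<omega> * cprob M F P \<omega>)"
    unfolding cprob_def using P by (intro real_cond_exp_intg int Z) simp
  have "(\<integral>\<omega>. Z \<omega> * cprob M F P \<omega> \<partial>M) = (\<integral>\<omega>. Z \<omega> * indicator {\<omega> \<in> space M. P \<omega>} \<omega> \<partial>M)"
    unfolding cprob_def using P by (intro real_cond_exp_intg int Z) simp
  also have "\<dots> = (\<integral>\<omega>. (if P \<omega> then Z \<omega> else 0) \<partial>M)"
    by (intro Bochner_Integration.integral_cong) (auto simp: indicator_def)
  finally show "(\<integral>\<omega>. Z \<omega> * cprob M F P \<omega> \<partial>M) = (\<integral>\<omega>. (if P \<omega> then Z \<omega> else 0) \<partial>M)" .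
qed

lemma integrable_if_bounded:
  assumes [measurable]: "Z \<in> borel_measurable M" "Measurable.pred M P"
    and Z: "\<And>\<omega>. 0 \<le> Z \<omega>" "\<And>\<omega>. Z \<omega> \<le> 1"
  shows "integrable M (\<lambda>\<omega>. if P \<omega> then Z \<omega> else (0::real))"
  using Z by (intro integrable_const_bound[where B = 1]) auto

text \<open>Extended-valued counterpart of \<open>integral_mult_cprob\<close>, suited to factors
  such as \<open>Omega\<close> that may be unbounded.\<close>

lemma nn_integral_mult_cprob:
  assumes F: "subalgebra M F" and Z: "Z \<in> borel_measurable F"
    and P: "{\<omega> \<in> space M. P \<omega>} \<in> sets M"
  shows "(\<integral>\<^sup>+\<omega>. Z \<omega> * ennreal (cprob M F P \<omega>) \<partial>M) = (\<integral>\<^sup>+\<omega>. (if P \<omega> then Z \<omega> else 0) \<partial>M)"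
proof -
  interpret finite_measure_subalgebra M F by unfold_locales fact
  let ?A = "{\<omega> \<in> space M. P \<omega>}"
  let ?n = "nn_cond_exp M F (indicator ?A)"
  have "AE \<omega> in M. nn_cond_exp M F (\<lambda>_. 0) \<omega> = 0"
    using nn_cond_exp_F_meas[of "\<lambda>_. 0"] by auto
  moreover have "AE \<omega> in M. ?n \<omega> \<le> 1"
  proof -
    have "AE \<omega> in M. ?n \<omega> \<le> nn_cond_exp M F (\<lambda>_. 1) \<omega>"
      using P by (intro nn_cond_exp_mono) (auto simp: indicator_def)
    with nn_cond_exp_F_meas[of "\<lambda>_. 1"] show ?thesis by auto
  qed
  \<comment> \<open>\<open>real_cond_exp\<close> is a difference of two \<open>enn2real\<close>
    terms. The negative part vanishes, and the bound by 1 excludes infinity, so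
    \<open>enn2real\<close> loses nothing.\<close>
  ultimately have "AE \<omega> in M. ennreal (cprob M F P \<omega>) = ?n \<omega>"
  proof eventually_elim
    case (elim \<omega>)
    have "ennreal (cprob M F P \<omega>) = ennreal (enn2real (?n \<omega>))"
      using elim(1) by (simp add: cprob_def real_cond_exp_def ennreal_indicator ennreal_neg)
    then show ?case using elim(2) by (simp add: ennreal_enn2real_if top_unique) (metis ennreal_one_neq_top top_unique)
  qed
  then have "(\<integral>\<^sup>+\<omega>. Z \<omega> * ennreal (cprob M F P \<omega>) \<partial>M) = (\<integral>\<^sup>+\<omega>. Z \<omega> * ?n \<omega> \<partial>M)"
    by (intro nn_integral_cong_AE) auto
  also have "\<dots> = (\<integral>\<^sup>+\<omega>. Z \<omega> * indicator ?A \<omega> \<partial>M)"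
    using P by (intro nn_cond_exp_intg Z) simp
  also have "\<dots> = (\<integral>\<^sup>+\<omega>. (if P \<omega> then Z \<omega> else 0) \<partial>M)"
    by (intro nn_integral_cong) (auto simp: indicator_def)
  finally show ?thesis .
qed

lemma cprob_eq_0_AE:
  assumes F: "subalgebra M F" and P: "{\<omega> \<in> space M. P \<omega>} \<in> sets M" "AE \<omega> in M. \<not> P \<omega>"
  shows "AE \<omega> in M. cprob M F P \<omega> = 0"
proof -
  interpret finite_measure_subalgebra M F by unfold_locales fact
  have "AE \<omega> in M. real_cond_exp M F (indicator {\<omega> \<in> space M. P \<omega>}) \<omega> = real_cond_exp M F (\<lambda>_. 0) \<omega>"
    using P by (intro real_cond_exp_cong) auto
  moreover have "AE \<omega> in M. real_cond_exp M F (\<lambda>_. 0) \<omega> = 0"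
    by (rule real_cond_exp_F_meas) auto
  ultimately show ?thesis by eventually_elim (simp add: cprob_def)
qed

lemma cprob_eq_1_AE:
  assumes F: "subalgebra M F" and P: "\<And>\<omega>. \<omega> \<in> space M \<Longrightarrow> P \<omega>"
  shows "AE \<omega> in M. cprob M F P \<omega> = 1"
proof -
  interpret finite_measure_subalgebra M F by unfold_locales fact
  have A: "{\<omega> \<in> space M. P \<omega>} = space M" using P by auto
  have "AE \<omega> in M. real_cond_exp M F (indicator (space M)) \<omega> = real_cond_exp M F (\<lambda>_. 1) \<omega>"
    by (intro real_cond_exp_cong) auto
  moreover have "AE \<omega> in M. real_cond_exp M F (\<lambda>_. 1) \<omega> = 1"
    by (rule real_cond_exp_F_meas) auto
  ultimately show ?thesis by eventually_elim (simp add: cprob_def A)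
qed

end

section \<open>Bounds through the sign likelihood ratios\<close>

lemma measurable_exp_ereal [measurable]: "exp_ereal \<in> borel_measurable borel"
proof -
  have eq: "exp_ereal = (\<lambda>x. if x = \<infinity> then \<infinity> else if x = -\<infinity> then 0 else ennreal (exp (real_of_ereal x)))"
    by (rule ext, rename_tac x, case_tac x) (auto simp: exp_ereal_def)
  show ?thesis unfolding eq by measurable
qed

locale knockoff_scores = prob_space M for M :: "'a measure" +
  fixes I H0 :: "nat set" and W :: "nat \<Rightarrow> 'a \<Rightarrow> real" and q :: real
  assumes finite_scores: "finite I"
    and null_subset: "H0 \<subseteq> I"
    and measurable_score: "\<And>i. i \<in> I \<Longrightarrow> W i \<in> borel_measurable M"
    and level_nonneg: "0 \<le> q"
begin

lemma finite_nulls: "finite H0"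
  using finite_scores null_subset finite_subset by blast

lemma measurable_null_score [measurable]: "j \<in> H0 \<Longrightarrow> W j \<in> borel_measurable M"
  using measurable_score null_subset by blast

lemma FDR_eq_expectation_fdp: "FDR M I H0 W q = (\<integral>\<omega>. fdp I H0 q (\<lambda>i. W i \<omega>) \<partial>M)"
  by (simp add: FDR_def fdp_def)

lemma integrable_fdp: "integrable M (\<lambda>\<omega>. fdp I H0 q (\<lambda>i. W i \<omega>))"
  using finite_scores measurable_score
  by (intro integrable_const_bound[where B = 1]) (auto intro!: borel_measurable_fdp)

abbreviation loo :: "nat \<Rightarrow> 'a \<Rightarrow> real" where
  "loo j \<omega> \<equiv> loo_weight I q j (\<lambda>i. W i \<omega>)"

lemma subalgebra_leave_sign:
  assumes "j \<in> H0" shows "subalgebra M (leave_sign_algebra M I W j)"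
  unfolding leave_sign_algebra_def
  using assms measurable_score measurable_null_score by (intro subalgebra_gen_algebra) auto

lemma measurable_loo:
  "(\<lambda>\<omega>. loo j \<omega>) \<in> borel_measurable (leave_sign_algebra M I W j)"
  unfolding leave_sign_algebra_def
  by (intro borel_measurable_loo_weight finite_scores measurable_gen_algebra) auto

lemma measurable_loo_M [measurable]: "j \<in> H0 \<Longrightarrow> (\<lambda>\<omega>. loo j \<omega>) \<in> borel_measurable M"
  using measurable_from_subalg[OF subalgebra_leave_sign measurable_loo] .

lemma measurable_Lambda [measurable]: "Lambda M I W j \<in> borel_measurable (leave_sign_algebra M I W j)"
proof -
  have [measurable]: "pos_prob M I W j \<in> borel_measurable (leave_sign_algebra M I W j)"
    "neg_prob M I W j \<in> borel_measurable (leave_sign_algebra M I W j)"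
    by (simp_all add: pos_prob_def neg_prob_def)
  show ?thesis unfolding Lambda_def[abs_def] by measurable
qed

lemma measurable_Omega [measurable]: "Omega M I W j \<in> borel_measurable (leave_sign_algebra M I W j)"
  unfolding Omega_def[abs_def] by measurable

lemma sign_prob_nonneg_AE:
  assumes j: "j \<in> H0"
  shows "AE \<omega> in M. 0 \<le> pos_prob M I W j \<omega> \<and> 0 \<le> neg_prob M I W j \<omega>"
  unfolding pos_prob_def neg_prob_def using j
  by (intro AE_conjI cprob_nonneg subalgebra_leave_sign prob_space_axioms) measurable

text \<open>A finite bound on \<open>Lambda\<close> excludes a zero denominator unless its
  convention \<open>\<infinity>\<close> is contradicted; a zero numerator is immediate; otherwise
  exponentiate.\<close>

lemma likelihood_ratio_le:
  assumes "Lambda M I W j \<omega> \<le> ereal \<epsilon>" "0 \<le> pos_prob M I W j \<omega>" "0 \<le> neg_prob M I W j \<omega>"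
  shows "pos_prob M I W j \<omega> \<le> exp \<epsilon> * neg_prob M I W j \<omega>"
proof (cases "pos_prob M I W j \<omega> = 0 \<or> neg_prob M I W j \<omega> = 0")
  case True
  then show ?thesis using assms by (auto simp: Lambda_def split: if_splits)
next
  case False
  then have pos: "0 < pos_prob M I W j \<omega>" "0 < neg_prob M I W j \<omega>" using assms by auto
  then have "ln (pos_prob M I W j \<omega> / neg_prob M I W j \<omega>) \<le> \<epsilon>"
    using assms(1) by (simp add: Lambda_def)
  then have "pos_prob M I W j \<omega> / neg_prob M I W j \<omega> \<le> exp \<epsilon>"
    using pos by (metis divide_pos_pos exp_le_cancel_iff exp_ln)
  then show ?thesis using pos by (simp add: divide_le_eq)
qed

text \<open>Where some \<open>Lambda\<close> exceeds the bound, the false discovery proportion is at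
  most 1, which costs the probability term. Elsewhere each sign exchange costs at most
  \<open>exp \<epsilon>\<close>.\<close>

lemma FDR_le_exp_Lambda_max:
  "FDR M I H0 W q \<le> exp \<epsilon> * q + measure M {\<omega> \<in> space M. Lambda_max M I H0 W \<omega> > ereal \<epsilon>}"
proof -
  \<comment> \<open>The truncation uses the individual \<open>Lambda\<close> of \<open>j\<close>
    rather than the maximum, so \<open>Z j\<close> remains measurable without the sign of score
    \<open>j\<close>. It only lowers the weight, so the bound on the negative sum carries
    over.\<close>
  define Z where "Z j \<omega> = (if Lambda M I W j \<omega> \<le> ereal \<epsilon> then loo j \<omega> else 0)" for j \<omega>
  have Z: "0 \<le> Z j \<omega>" "Z j \<omega> \<le> 1" "Z j \<omega> \<le> loo j \<omega>" for j \<omega> by (auto simp: Z_def)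
  have ZF: "Z j \<in> borel_measurable (leave_sign_algebra M I W j)" for j
  proof -
    note measurable_loo[of j, measurable]
    show ?thesis unfolding Z_def[abs_def] by measurable
  qed
  have ZM[measurable]: "Z j \<in> borel_measurable M" if "j \<in> H0" for j
    by (rule measurable_from_subalg[OF subalgebra_leave_sign[OF that] ZF])
  have LM[measurable]: "Lambda M I W j \<in> borel_measurable M" if "j \<in> H0" for j
    by (rule measurable_from_subalg[OF subalgebra_leave_sign[OF that] measurable_Lambda])
  let ?B = "{\<omega> \<in> space M. Lambda_max M I H0 W \<omega> > ereal \<epsilon>}"
  have B_iff: "Lambda_max M I H0 W \<omega> > ereal \<epsilon> \<longleftrightarrow> (\<exists>j\<in>H0. Lambda M I W j \<omega> > ereal \<epsilon>)" for \<omega>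
    using finite_nulls by (auto simp: Lambda_max_def Max_gr_iff)
  have B[measurable]: "?B \<in> sets M"
    unfolding B_iff using finite_nulls by measurable
  have int_pos: "integrable M (\<lambda>\<omega>. if 0 < W j \<omega> then Z j \<omega> else 0)"
    and int_neg: "integrable M (\<lambda>\<omega>. if W j \<omega> < 0 then Z j \<omega> else 0)" if j: "j \<in> H0" for j
    using j by (auto intro!: integrable_if_bounded Z)
  have swap: "(\<integral>\<omega>. (if 0 < W j \<omega> then Z j \<omega> else 0) \<partial>M)
      \<le> exp \<epsilon> * (\<integral>\<omega>. (if W j \<omega> < 0 then Z j \<omega> else 0) \<partial>M)" if j: "j \<in> H0" for j
  proof -
    have P: "{\<omega> \<in> space M. 0 < W j \<omega>} \<in> sets M" "{\<omega> \<in> space M. W j \<omega> < 0} \<in> sets M"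
      using j by measurable
    note pos = integral_mult_cprob[OF subalgebra_leave_sign[OF j] ZF Z(1,2) P(1), folded pos_prob_def]
    note neg = integral_mult_cprob[OF subalgebra_leave_sign[OF j] ZF Z(1,2) P(2), folded neg_prob_def]
    have "(\<integral>\<omega>. Z j \<omega> * pos_prob M I W j \<omega> \<partial>M) \<le> (\<integral>\<omega>. exp \<epsilon> * (Z j \<omega> * neg_prob M I W j \<omega>) \<partial>M)"
    proof (rule integral_mono_AE)
      show "AE \<omega> in M. Z j \<omega> * pos_prob M I W j \<omega> \<le> exp \<epsilon> * (Z j \<omega> * neg_prob M I W j \<omega>)"
        using sign_prob_nonneg_AE[OF j]
      proof eventually_elim
        case (elim \<omega>)
        show ?case
        proof (cases "Lambda M I W j \<omega> \<le> ereal \<epsilon>")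
          case True
          then have "loo j \<omega> * pos_prob M I W j \<omega> \<le> loo j \<omega> * (exp \<epsilon> * neg_prob M I W j \<omega>)"
            using elim by (intro mult_left_mono likelihood_ratio_le) auto
          then show ?thesis using True by (simp add: Z_def mult.left_commute)
        qed (simp add: Z_def)
      qed
    qed (use pos neg in auto)
    then show ?thesis using pos(2) neg(2) by simp
  qed
  have bound: "fdp I H0 q (\<lambda>i. W i \<omega>) \<le> indicator ?B \<omega> + q * (\<Sum>j\<in>H0. if 0 < W j \<omega> then Z j \<omega> else 0)"
    if "\<omega> \<in> space M" for \<omega>
  proof (cases "\<omega> \<in> ?B")
    case True
    have "0 \<le> q * (\<Sum>j\<in>H0. if 0 < W j \<omega> then Z j \<omega> else 0)"
      using Z level_nonneg by (intro mult_nonneg_nonneg sum_nonneg) auto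
    moreover have "fdp I H0 q (\<lambda>i. W i \<omega>) \<le> 1" by (rule fdp_le_1[OF finite_scores])
    ultimately show ?thesis using True by simp
  next
    case False
    then have "Lambda M I W j \<omega> \<le> ereal \<epsilon>" if "j \<in> H0" for j
      using that \<open>\<omega> \<in> space M\<close> B_iff[of \<omega>] by auto
    then have "(\<Sum>j\<in>H0. if 0 < W j \<omega> then Z j \<omega> else 0) = (\<Sum>j\<in>H0. if 0 < W j \<omega> then loo j \<omega> else 0)"
      by (intro sum.cong) (auto simp: Z_def)
    with False show ?thesis
      using fdp_le[OF finite_scores null_subset level_nonneg, of "\<lambda>i. W i \<omega>"] by simp
  qed
  have "FDR M I H0 W q \<le> (\<integral>\<omega>. indicator ?B \<omega> + q * (\<Sum>j\<in>H0. if 0 < W j \<omega> then Z j \<omega> else 0) \<partial>M)"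
    unfolding FDR_eq_expectation_fdp
    using int_pos bound by (intro integral_mono integrable_fdp) (auto simp: emeasure_eq_measure)
  also have "\<dots> = measure M ?B + q * (\<Sum>j\<in>H0. \<integral>\<omega>. (if 0 < W j \<omega> then Z j \<omega> else 0) \<partial>M)"
    using int_pos by (subst Bochner_Integration.integral_add) (auto simp: emeasure_eq_measure)
  also have "\<dots> \<le> measure M ?B + q * (\<Sum>j\<in>H0. exp \<epsilon> * (\<integral>\<omega>. (if W j \<omega> < 0 then Z j \<omega> else 0) \<partial>M))"
    using level_nonneg by (intro add_left_mono mult_left_mono sum_mono swap) auto
  also have "\<dots> = measure M ?B + exp \<epsilon> * q * (\<integral>\<omega>. (\<Sum>j\<in>H0. if W j \<omega> < 0 then Z j \<omega> else 0) \<partial>M)"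
    using int_neg by (simp flip: sum_distrib_left)
  also have "\<dots> \<le> measure M ?B + exp \<epsilon> * q * (\<integral>\<omega>. 1 \<partial>M)"
  proof (intro add_left_mono mult_left_mono integral_mono)
    fix \<omega>
    have "(\<Sum>j\<in>H0. if W j \<omega> < 0 then Z j \<omega> else 0) \<le> (\<Sum>j\<in>H0. if W j \<omega> < 0 then loo j \<omega> else 0)"
      using Z(3) by (intro sum_mono) auto
    also have "\<dots> \<le> 1" by (rule negative_loo_weight_sum_le[OF finite_scores null_subset])
    finally show "(\<Sum>j\<in>H0. if W j \<omega> < 0 then Z j \<omega> else 0) \<le> 1" .
  qed (use int_neg level_nonneg in auto)
  finally show ?thesis by (simp add: prob_space)
qed

lemma FDR_le_I_q:
  assumes pos: "\<And>j. j \<in> H0 \<Longrightarrow> AE \<omega> in M. pos_prob M I W j \<omega> > 0 \<and> neg_prob M I W j \<omega> > 0"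
  shows "ennreal (FDR M I H0 W q) \<le> ennreal q * I_q M I H0 W q"
proof -
  have OM[measurable]: "Omega M I W j \<in> borel_measurable M" if "j \<in> H0" for j
    by (rule measurable_from_subalg[OF subalgebra_leave_sign[OF that] measurable_Omega])
  \<comment> \<open>Here the exchange is an identity: positivity of both conditional probabilities
    makes \<open>Omega\<close> their finite quotient, and the denominator cancels.\<close>
  have swap: "(\<integral>\<^sup>+\<omega>. ennreal (if 0 < W j \<omega> then loo j \<omega> else 0) \<partial>M)
      = (\<integral>\<^sup>+\<omega>. (if W j \<omega> < 0 then Omega M I W j \<omega> * ennreal (loo j \<omega>) else 0) \<partial>M)" if j: "j \<in> H0" for j
  proof -
    have P: "{\<omega> \<in> space M. 0 < W j \<omega>} \<in> sets M" "{\<omega> \<in> space M. W j \<omega> < 0} \<in> sets M"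
      using j by measurable
    note measurable_loo[of j, measurable]
    have "(\<integral>\<^sup>+\<omega>. ennreal (if 0 < W j \<omega> then loo j \<omega> else 0) \<partial>M)
        = (\<integral>\<^sup>+\<omega>. (if 0 < W j \<omega> then ennreal (loo j \<omega>) else 0) \<partial>M)"
      by (intro nn_integral_cong) auto
    also have "\<dots> = (\<integral>\<^sup>+\<omega>. ennreal (loo j \<omega>) * ennreal (pos_prob M I W j \<omega>) \<partial>M)"
      unfolding pos_prob_def
      by (rule nn_integral_mult_cprob[OF subalgebra_leave_sign[OF j] _ P(1), symmetric]) measurable
    also have "\<dots> = (\<integral>\<^sup>+\<omega>. (Omega M I W j \<omega> * ennreal (loo j \<omega>)) * ennreal (neg_prob M I W j \<omega>) \<partial>M)"
    proof (rule nn_integral_cong_AE)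
      show "AE \<omega> in M. ennreal (loo j \<omega>) * ennreal (pos_prob M I W j \<omega>)
          = Omega M I W j \<omega> * ennreal (loo j \<omega>) * ennreal (neg_prob M I W j \<omega>)"
        using pos[OF j]
      proof eventually_elim
        case (elim \<omega>)
        then have "Omega M I W j \<omega> = ennreal (pos_prob M I W j \<omega> / neg_prob M I W j \<omega>)"
          by (simp add: Omega_def Lambda_def exp_ereal_def)
        then show ?case using elim
          by (simp flip: ennreal_mult add: mult.commute)
      qed
    qed
    also have "\<dots> = (\<integral>\<^sup>+\<omega>. (if W j \<omega> < 0 then Omega M I W j \<omega> * ennreal (loo j \<omega>) else 0) \<partial>M)"
      unfolding neg_prob_def
      by (rule nn_integral_mult_cprob[OF subalgebra_leave_sign[OF j] _ P(2)]) measurable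
    finally show ?thesis .
  qed
  have pointwise: "(\<Sum>j\<in>H0. if W j \<omega> < 0 then Omega M I W j \<omega> * ennreal (loo j \<omega>) else 0)
      \<le> (let A = A_set I H0 q (\<lambda>i. W i \<omega>) in
          if A = {} then 0 else (\<Sum>j\<in>A. Omega M I W j \<omega>) / of_nat (card A))" for \<omega>
  proof -
    let ?A = "A_set I H0 q (\<lambda>i. W i \<omega>)"
    have A: "?A \<subseteq> H0" by (auto simp: A_set_def)
    have finA: "finite ?A" using A finite_nulls by (rule finite_subset)
    have "(\<Sum>j\<in>H0. if W j \<omega> < 0 then Omega M I W j \<omega> * ennreal (loo j \<omega>) else 0)
        = (\<Sum>j\<in>?A. Omega M I W j \<omega> * ennreal (loo j \<omega>))"
      using finite_nulls A
      by (intro sum.mono_neutral_cong_right) (auto simp: A_set_iff[OF finite_scores null_subset] loo_weight_def)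
    also have "\<dots> \<le> (\<Sum>j\<in>?A. Omega M I W j \<omega> / of_nat (card ?A))"
    proof (rule sum_mono)
      fix j assume j: "j \<in> ?A"
      then have card: "0 < card ?A" using finA by (auto simp: card_gt_0_iff)
      have "ennreal (loo j \<omega>) \<le> ennreal (1 / real (card ?A))"
        using loo_weight_le_inverse_card_A_set[OF finite_scores null_subset j] by (rule ennreal_leI)
      also have "\<dots> = 1 / of_nat (card ?A)"
        using card by (simp add: divide_ennreal[symmetric] ennreal_of_nat_eq_real_of_nat)
      finally have "Omega M I W j \<omega> * ennreal (loo j \<omega>) \<le> Omega M I W j \<omega> * (1 / of_nat (card ?A))"
        by (intro mult_left_mono) auto
      then show "Omega M I W j \<omega> * ennreal (loo j \<omega>) \<le> Omega M I W j \<omega> / of_nat (card ?A)"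
        by (simp add: ennreal_times_divide)
    qed
    also have "\<dots> = (\<Sum>j\<in>?A. Omega M I W j \<omega>) / of_nat (card ?A)"
      by (simp add: divide_ennreal_def sum_distrib_right)
    finally show ?thesis by (auto simp: Let_def)
  qed
  have "ennreal (FDR M I H0 W q) = (\<integral>\<^sup>+\<omega>. ennreal (fdp I H0 q (\<lambda>i. W i \<omega>)) \<partial>M)"
    unfolding FDR_eq_expectation_fdp
    by (intro nn_integral_eq_integral[symmetric] integrable_fdp) auto
  also have "\<dots> \<le> (\<integral>\<^sup>+\<omega>. ennreal q * (\<Sum>j\<in>H0. ennreal (if 0 < W j \<omega> then loo j \<omega> else 0)) \<partial>M)"
  proof (rule nn_integral_mono)
    fix \<omega>
    have "ennreal (fdp I H0 q (\<lambda>i. W i \<omega>)) \<le> ennreal (q * (\<Sum>j\<in>H0. if 0 < W j \<omega> then loo j \<omega> else 0))"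
      by (intro ennreal_leI fdp_le finite_scores null_subset level_nonneg)
    also have "\<dots> = ennreal q * (\<Sum>j\<in>H0. ennreal (if 0 < W j \<omega> then loo j \<omega> else 0))"
      using level_nonneg by (subst ennreal_mult) (auto intro!: sum_nonneg simp: sum_ennreal)
    finally show "ennreal (fdp I H0 q (\<lambda>i. W i \<omega>))
      \<le> ennreal q * (\<Sum>j\<in>H0. ennreal (if 0 < W j \<omega> then loo j \<omega> else 0))" .
  qed
  also have "\<dots> = ennreal q * (\<Sum>j\<in>H0. \<integral>\<^sup>+\<omega>. ennreal (if 0 < W j \<omega> then loo j \<omega> else 0) \<partial>M)"
    by (subst nn_integral_cmult, measurable, subst nn_integral_sum) measurable
  also have "\<dots> = ennreal q * (\<integral>\<^sup>+\<omega>. (\<Sum>j\<in>H0. if W j \<omega> < 0 then Omega M I W j \<omega> * ennreal (loo j \<omega>) else 0) \<partial>M)"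
    by (subst nn_integral_sum) (auto simp: swap)
  also have "\<dots> \<le> ennreal q * I_q M I H0 W q"
    unfolding I_q_def by (intro mult_left_mono nn_integral_mono pointwise) simp
  finally show ?thesis .
qed

text \<open>An average over \<open>A_set\<close> is at most the maximum over the negative nulls,
  which contain it. An empty \<open>A_set\<close> contributes 0, below the 1 on the right.\<close>

lemma I_q_le_M_minus: "I_q M I H0 W q \<le> M_minus M I H0 W"
  unfolding I_q_def M_minus_def
proof (rule nn_integral_mono)
  fix \<omega>
  let ?A = "A_set I H0 q (\<lambda>i. W i \<omega>)"
  let ?m = "Max (insert 0 ((\<lambda>j. Omega M I W j \<omega>) ` {j \<in> H0. W j \<omega> < 0}))"
  have "?A \<subseteq> {j \<in> H0. W j \<omega> < 0}" by (auto simp: A_set_iff[OF finite_scores null_subset])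
  moreover from this have finA: "finite ?A" using finite_nulls by (auto dest: finite_subset)
  ultimately have "Omega M I W j \<omega> \<le> ?m" if "j \<in> ?A" for j
    using that finite_nulls by (intro Max_ge) auto
  then have "(\<Sum>j\<in>?A. Omega M I W j \<omega>) \<le> of_nat (card ?A) * ?m"
    by (rule sum_bounded_above)
  then have "(\<Sum>j\<in>?A. Omega M I W j \<omega>) / of_nat (card ?A) \<le> of_nat (card ?A) * ?m / of_nat (card ?A)"
    by (rule divide_right_mono_ennreal)
  also have "\<dots> = ?m" if "?A \<noteq> {}"
    using that finA by (subst mult.commute) (simp add: ennreal_mult_divide_eq card_gt_0_iff)
  finally show "(let A = ?A in if A = {} then 0 else (\<Sum>j\<in>A. Omega M I W j \<omega>) / of_nat (card A)) \<le> max 1 ?m"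
    by (auto simp: Let_def le_max_iff_disj)
qed

end

section \<open>Bounds through the conditional sign law\<close>

definition fair_mass :: "nat set \<Rightarrow> (nat \<Rightarrow> real) \<Rightarrow> real" where
  "fair_mass H0 s = (\<Prod>j\<in>H0. if s j = 0 then 0 else 1 / 2)"

lemma fair_mass_nonneg [simp]: "0 \<le> fair_mass H0 s"
  by (auto simp: fair_mass_def intro: prod_nonneg)

lemma finite_sign_vectors: "finite H0 \<Longrightarrow> finite (sign_vectors H0)"
  by (simp add: sign_vectors_def finite_PiE)

lemma fair_mass_eq:
  assumes "finite H0" "s \<in> sign_vectors H0"
  shows "fair_mass H0 s = (if s \<in> (\<Pi>\<^sub>E j\<in>H0. {-1, 1}) then 1 / 2 ^ card H0 else 0)"
proof (cases "\<exists>j\<in>H0. s j = 0")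
  case True
  then have "s \<notin> (\<Pi>\<^sub>E j\<in>H0. {-1, 1})" by (metis PiE_mem insertE neg_0_equal_iff_equal singletonD zero_neq_one)
  with True show ?thesis using assms(1) by (auto simp: fair_mass_def)
next
  case False
  then have "fair_mass H0 s = (\<Prod>j\<in>H0. 1 / 2)"
    unfolding fair_mass_def by (intro prod.cong) auto
  moreover have "s \<in> (\<Pi>\<^sub>E j\<in>H0. {-1, 1})"
  proof (rule PiE_I)
    fix j assume j: "j \<in> H0"
    then have "s j \<in> {-1, 0, 1}" using assms(2) by (auto simp: sign_vectors_def PiE_iff)
    then show "s j \<in> {-1, 1}" using False j by auto
  next
    fix j assume "j \<notin> H0"
    then show "s j = undefined" using assms(2) by (auto simp: sign_vectors_def PiE_iff extensional_def)
  qed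
  ultimately show ?thesis by (simp add: power_one_over)
qed

text \<open>Vectors with a zero entry carry no mass, so the expectation is a plain average over
  signs in \<open>{-1, 1}\<close>, the form bounded by \<open>sum_fdp_with_signs_le\<close>.\<close>

lemma sum_mult_fair_mass:
  assumes "finite H0"
  shows "(\<Sum>s\<in>sign_vectors H0. g s * fair_mass H0 s) = (\<Sum>s\<in>(\<Pi>\<^sub>E j\<in>H0. {-1, 1}). g s) / 2 ^ card H0"
proof -
  have sub: "(\<Pi>\<^sub>E j\<in>H0. {-1, 1}) \<subseteq> sign_vectors H0"
    unfolding sign_vectors_def by (intro PiE_mono) auto
  have "(\<Sum>s\<in>sign_vectors H0. g s * fair_mass H0 s)
      = (\<Sum>s\<in>(\<Pi>\<^sub>E j\<in>H0. {-1, 1}). g s * (1 / 2 ^ card H0))"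
    using assms sub
    by (intro sum.mono_neutral_cong_right finite_sign_vectors) (auto simp: fair_mass_eq)
  then show ?thesis by (simp add: sum_divide_distrib)
qed

lemma sum_fair_mass: "finite H0 \<Longrightarrow> (\<Sum>s\<in>sign_vectors H0. fair_mass H0 s) = 1"
  using sum_mult_fair_mass[of H0 "\<lambda>_. 1"] by (simp add: card_PiE)

text \<open>A crude bound that serves to dominate the divergence by a constant and so make it
  integrable.\<close>

lemma abs_xlnx_le:
  fixes x :: real assumes "0 \<le> x" shows "\<bar>x * ln x\<bar> \<le> 1 + x\<^sup>2"
proof (cases "x = 0")
  case False
  with assms have x: "0 < x" by simp
  have "x * ln x \<le> x * x" using x ln_le_minus_one[OF x] by (intro mult_left_mono) auto
  moreover have "- 1 \<le> x * ln x"
  proof -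
    have "ln (1 / x) \<le> 1 / x - 1" using x by (intro ln_le_minus_one) simp
    then have "x * ln (1 / x) \<le> x * (1 / x - 1)" using x by (intro mult_left_mono) auto
    then show ?thesis using x by (simp add: ln_div right_diff_distrib)
  qed
  moreover have "0 \<le> x\<^sup>2" by simp
  ultimately show ?thesis unfolding power2_eq_square by linarith
qed simp

section \<open>The conditional sign law given magnitudes and non-null scores\<close>

context knockoff_scores
begin

definition sign_free_algebra :: "'a measure" where
  "sign_free_algebra = gen_algebra M ({(\<lambda>\<omega>. \<bar>W i \<omega>\<bar>) |i. i \<in> I} \<union> {W i |i. i \<in> I - H0})"

text \<open>The truncation at \<open>0\<close> is harmless almost everywhere and makes the conditional sign
  law a point measure with nonnegative real masses at every outcome.\<close>

definition sign_mass :: "(nat \<Rightarrow> real) \<Rightarrow> 'a \<Rightarrow> real" where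
  "sign_mass s \<omega> = max 0 (cprob M sign_free_algebra (\<lambda>\<omega>'. null_signs H0 W \<omega>' = s) \<omega>)"

abbreviation S :: "(nat \<Rightarrow> real) set" where "S \<equiv> sign_vectors H0"

abbreviation sign_KL :: "'a \<Rightarrow> real" where
  "sign_KL \<omega> \<equiv> KL_divergence (exp 1) (fair_signs H0) (null_sign_law M I H0 W \<omega>)"

abbreviation sign_tv :: "'a \<Rightarrow> real" where
  "sign_tv \<omega> \<equiv> tv_dist (null_sign_law M I H0 W \<omega>) (fair_signs H0)"

lemma finite_S [simp]: "finite S"
  by (rule finite_sign_vectors[OF finite_nulls])

lemma sign_mass_nonneg [simp]: "0 \<le> sign_mass s \<omega>"
  by (simp add: sign_mass_def)

text \<open>\<open>ennreal\<close> sends negative numbers to 0, so the truncated masses define the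
  same measure at every outcome.\<close>

lemma null_sign_law_eq: "null_sign_law M I H0 W \<omega> = point_measure S (\<lambda>s. ennreal (sign_mass s \<omega>))"
  by (simp add: null_sign_law_def cond_law_def sign_mass_def sign_free_algebra_def)

lemma fair_signs_eq: "fair_signs H0 = point_measure S (\<lambda>s. ennreal (fair_mass H0 s))"
  using fair_signs_eq_point_measure[OF finite_nulls] by (simp add: fair_mass_def)

lemma subalgebra_sign_free: "subalgebra M sign_free_algebra"
  unfolding sign_free_algebra_def
  using measurable_score by (intro subalgebra_gen_algebra) auto

lemma measurable_sign_mass_sign_free: "sign_mass s \<in> borel_measurable sign_free_algebra"
  unfolding sign_mass_def[abs_def] by measurable

lemma measurable_sign_mass [measurable]: "sign_mass s \<in> borel_measurable M"
  by (rule measurable_from_subalg[OF subalgebra_sign_free measurable_sign_mass_sign_free])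

lemma null_signs_in_S: "null_signs H0 W \<omega> \<in> S"
  by (auto simp: null_signs_def sign_vectors_def sgn_if)

lemma null_signs_event [measurable]: "Measurable.pred M (\<lambda>\<omega>. null_signs H0 W \<omega> = s)"
proof (cases "s \<in> extensional H0")
  case True
  then have eq: "null_signs H0 W \<omega> = s \<longleftrightarrow> (\<forall>j\<in>H0. sgn (W j \<omega>) = s j)" for \<omega>
    by (auto simp: null_signs_def extensional_def fun_eq_iff)
  show ?thesis unfolding eq
    using finite_nulls by (intro pred_intros_finite(3)) (auto intro: measurable_null_score)
next
  case False
  then have "null_signs H0 W \<omega> \<noteq> s" for \<omega> by (auto simp: null_signs_def)
  then show ?thesis by simp
qed

lemma measurable_null_signs: "null_signs H0 W \<in> measurable M (count_space S)"
  using null_signs_in_S null_signs_event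
  by (subst measurable_count_space_eq2) (auto simp: pred_def vimage_def Int_def conj_commute)

lemma sign_mass_eq_cprob_AE:
  "AE \<omega> in M. sign_mass s \<omega> = cprob M sign_free_algebra (\<lambda>\<omega>'. null_signs H0 W \<omega>' = s) \<omega>"
  using cprob_nonneg[OF prob_space_axioms subalgebra_sign_free, of "\<lambda>\<omega>'. null_signs H0 W \<omega>' = s"]
    null_signs_event[of s]
  by (auto simp: sign_mass_def pred_def)

lemma sum_sign_mass_AE: "AE \<omega> in M. (\<Sum>s\<in>S. sign_mass s \<omega>) = 1"
proof -
  have "AE \<omega> in M. measure (null_sign_law M I H0 W \<omega>) S
      = cprob M sign_free_algebra (\<lambda>\<omega>'. null_signs H0 W \<omega>' \<in> S) \<omega>"
    unfolding null_sign_law_def sign_free_algebra_def[symmetric]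
    by (rule cond_law_version[OF prob_space_axioms subalgebra_sign_free finite_S measurable_null_signs]) simp
  moreover have "AE \<omega> in M. cprob M sign_free_algebra (\<lambda>\<omega>'. null_signs H0 W \<omega>' \<in> S) \<omega> = 1"
    by (rule cprob_eq_1_AE[OF subalgebra_sign_free null_signs_in_S])
  ultimately show ?thesis
    by eventually_elim (simp add: null_sign_law_eq measure_point_measure_finite_if)
qed

lemma sign_tv_eq:
  "sign_tv \<omega> = (SUP A\<in>Pow S. \<bar>(\<Sum>s\<in>A. sign_mass s \<omega>) - (\<Sum>s\<in>A. fair_mass H0 s)\<bar>)"
  unfolding null_sign_law_eq fair_signs_eq by (simp add: tv_dist_point_measure)

lemma measurable_sign_tv [measurable]: "sign_tv \<in> borel_measurable M"
  unfolding sign_tv_eq by (intro borel_measurable_cSUP) (auto intro: countable_finite)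

lemma sign_KL_eq:
  "sign_KL \<omega> = (if \<forall>s\<in>S. fair_mass H0 s = 0 \<longrightarrow> sign_mass s \<omega> = 0
     then \<Sum>s\<in>S. sign_mass s \<omega> * ln (sign_mass s \<omega> / fair_mass H0 s) else 0)"
  unfolding null_sign_law_eq fair_signs_eq by (rule KL_divergence_point_measure) auto

lemma measurable_sign_KL [measurable]: "sign_KL \<in> borel_measurable M"
proof -
  have [measurable]: "Measurable.pred M (\<lambda>\<omega>. \<forall>s\<in>S. fair_mass H0 s = 0 \<longrightarrow> sign_mass s \<omega> = 0)"
    by (intro pred_intros_finite(3) finite_S) measurable
  show ?thesis unfolding sign_KL_eq by measurable
qed

lemma sign_tv_nonneg: "0 \<le> sign_tv \<omega>"
  unfolding sign_tv_eq by (rule cSUP_upper2[of _ _ "{}"]) auto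

text \<open>The false discovery proportion that would result if the null signs were
  \<open>s\<close>.\<close>

definition sign_score :: "(nat \<Rightarrow> real) \<Rightarrow> 'a \<Rightarrow> real" where
  "sign_score s \<omega> = fdp I H0 q (with_signs H0 (\<lambda>i. W i \<omega>) s)"

lemma sign_score_bounds [simp]: "0 \<le> sign_score s \<omega>" "sign_score s \<omega> \<le> 1"
  by (simp_all add: sign_score_def finite_scores)

lemma measurable_sign_score: "sign_score s \<in> borel_measurable sign_free_algebra"
proof -
  have "(\<lambda>\<omega>. fdp I H0 q (\<lambda>i. (if i \<in> H0 then \<lambda>\<omega>. s i * \<bar>W i \<omega>\<bar> else W i) \<omega>))
      \<in> borel_measurable sign_free_algebra"
  proof (intro borel_measurable_fdp finite_scores)
    fix i assume i: "i \<in> I"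
    have "(\<lambda>\<omega>. \<bar>W i \<omega>\<bar>) \<in> borel_measurable sign_free_algebra"
      unfolding sign_free_algebra_def using i by (intro measurable_gen_algebra) auto
    moreover have "W i \<in> borel_measurable sign_free_algebra" if "i \<notin> H0"
      unfolding sign_free_algebra_def using i that by (intro measurable_gen_algebra) auto
    ultimately show "(if i \<in> H0 then \<lambda>\<omega>. s i * \<bar>W i \<omega>\<bar> else W i) \<in> borel_measurable sign_free_algebra"
      by auto
  qed
  moreover have "with_signs H0 (\<lambda>i. W i \<omega>) s = (\<lambda>i. (if i \<in> H0 then \<lambda>\<omega>. s i * \<bar>W i \<omega>\<bar> else W i) \<omega>)" for \<omega>
    by (auto simp: with_signs_def)
  ultimately show ?thesis by (simp add: sign_score_def[abs_def])
qed

text \<open>Split according to the realised sign vector. Each score is measurable in the sign-free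
  algebra, so the indicator of that vector may be replaced by its conditional probability.\<close>

lemma FDR_eq_sum_sign_score:
  "integrable M (\<lambda>\<omega>. \<Sum>s\<in>S. sign_score s \<omega> * sign_mass s \<omega>)"
  "FDR M I H0 W q = (\<integral>\<omega>. (\<Sum>s\<in>S. sign_score s \<omega> * sign_mass s \<omega>) \<partial>M)"
proof -
  have ev: "{\<omega> \<in> space M. null_signs H0 W \<omega> = s} \<in> sets M" for s
    using null_signs_event by (simp add: pred_def)
  note tower = integral_mult_cprob[OF subalgebra_sign_free measurable_sign_score sign_score_bounds ev]
  note [measurable] = measurable_from_subalg[OF subalgebra_sign_free measurable_sign_score]
  have AE: "AE \<omega> in M. sign_score s \<omega> * cprob M sign_free_algebra (\<lambda>\<omega>'. null_signs H0 W \<omega>' = s) \<omega>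
      = sign_score s \<omega> * sign_mass s \<omega>" for s
    using sign_mass_eq_cprob_AE[of s] by auto
  have cm: "cprob M sign_free_algebra (\<lambda>\<omega>'. null_signs H0 W \<omega>' = s) \<in> borel_measurable M" for s
    by (rule measurable_from_subalg[OF subalgebra_sign_free]) measurable
  note [measurable] = cm
  have int: "integrable M (\<lambda>\<omega>. sign_score s \<omega> * sign_mass s \<omega>)" for s
    using tower(1)[of s s] by (rule integrable_cong_AE_imp[OF _ _ AE]) measurable
  have eq: "(\<integral>\<omega>. sign_score s \<omega> * sign_mass s \<omega> \<partial>M)
      = (\<integral>\<omega>. (if null_signs H0 W \<omega> = s then sign_score s \<omega> else 0) \<partial>M)" for s
    unfolding tower(2)[symmetric] by (rule integral_cong_AE[OF _ _ AE, symmetric]) measurable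
  show "integrable M (\<lambda>\<omega>. \<Sum>s\<in>S. sign_score s \<omega> * sign_mass s \<omega>)"
    by (intro Bochner_Integration.integrable_sum int)
  have "fdp I H0 q (\<lambda>i. W i \<omega>) = (\<Sum>s\<in>S. if null_signs H0 W \<omega> = s then sign_score s \<omega> else 0)" for \<omega>
  proof -
    \<comment> \<open>Putting back the realised signs recovers the scores, because
      \<open>sgn x * \<bar>x\<bar> = x\<close>, also at 0.\<close>
    have "with_signs H0 (\<lambda>i. W i \<omega>) (null_signs H0 W \<omega>) = (\<lambda>i. W i \<omega>)"
      by (rule ext) (simp add: with_signs_def null_signs_def sgn_if)
    then show ?thesis using null_signs_in_S[of \<omega>] by (simp add: sign_score_def)
  qed
  then have "FDR M I H0 W q = (\<integral>\<omega>. (\<Sum>s\<in>S. if null_signs H0 W \<omega> = s then sign_score s \<omega> else 0) \<partial>M)"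
    by (simp add: FDR_eq_expectation_fdp)
  also have "\<dots> = (\<Sum>s\<in>S. \<integral>\<omega>. (if null_signs H0 W \<omega> = s then sign_score s \<omega> else 0) \<partial>M)"
    by (intro Bochner_Integration.integral_sum integrable_const_bound[where B = 1]) auto
  also have "\<dots> = (\<integral>\<omega>. (\<Sum>s\<in>S. sign_score s \<omega> * sign_mass s \<omega>) \<partial>M)"
    using int by (simp add: eq)
  finally show "FDR M I H0 W q = (\<integral>\<omega>. (\<Sum>s\<in>S. sign_score s \<omega> * sign_mass s \<omega>) \<partial>M)" .
qed

lemma sum_sign_score_le: "(\<Sum>s\<in>S. sign_score s \<omega> * sign_mass s \<omega>) \<le> q + sign_tv \<omega>"
proof -
  have "(\<Sum>s\<in>S. sign_score s \<omega> * sign_mass s \<omega>)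
      \<le> (\<Sum>s\<in>S. sign_score s \<omega> * fair_mass H0 s) + sign_tv \<omega>"
    unfolding null_sign_law_eq fair_signs_eq by (rule sum_le_tv_dist) auto
  also have "(\<Sum>s\<in>S. sign_score s \<omega> * fair_mass H0 s) \<le> q"
    using sum_fdp_with_signs_le[OF finite_scores null_subset level_nonneg, of "\<lambda>i. W i \<omega>"]
    by (simp add: sum_mult_fair_mass[OF finite_nulls] sign_score_def divide_le_eq)
  finally show ?thesis by simp
qed

section \<open>Absolute continuity, Pinsker's bound and integration\<close>

context
  assumes null_nonzero: "\<And>j. j \<in> H0 \<Longrightarrow> AE \<omega> in M. W j \<omega> \<noteq> 0"
begin

text \<open>Absolute continuity with respect to fair signs: a vector of zero fair mass has a zero
  entry, and a null score vanishes with probability zero.\<close>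

lemma sign_mass_zero_AE: "AE \<omega> in M. \<forall>s\<in>S. fair_mass H0 s = 0 \<longrightarrow> sign_mass s \<omega> = 0"
proof (intro AE_finite_allI finite_S)
  fix s assume "s \<in> S"
  show "AE \<omega> in M. fair_mass H0 s = 0 \<longrightarrow> sign_mass s \<omega> = 0"
  proof (cases "fair_mass H0 s = 0")
    case True
    then obtain j where j: "j \<in> H0" "s j = 0"
      using finite_nulls by (auto simp: fair_mass_def split: if_splits)
    have "AE \<omega> in M. null_signs H0 W \<omega> \<noteq> s"
      using null_nonzero[OF j(1)]
    proof eventually_elim
      case (elim \<omega>)
      then have "null_signs H0 W \<omega> j \<noteq> s j" using j by (simp add: null_signs_def sgn_zero_iff)
      then show ?case by auto
    qed
    then have "AE \<omega> in M. cprob M sign_free_algebra (\<lambda>\<omega>'. null_signs H0 W \<omega>' = s) \<omega> = 0"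
      using null_signs_event[of s] by (intro cprob_eq_0_AE[OF subalgebra_sign_free]) (auto simp: pred_def)
    then show ?thesis by (auto simp: sign_mass_def)
  qed simp
qed

text \<open>Pinsker's inequality holds wherever the conditional masses sum to one and are absolutely
  continuous. The two constant bounds supply integrability of the distance and the
  divergence.\<close>

lemma sign_law_AE:
  "AE \<omega> in M. sign_tv \<omega> \<le> sqrt (sign_KL \<omega> / 2) \<and> sign_tv \<omega> \<le> 1
     \<and> \<bar>sign_KL \<omega>\<bar> \<le> (\<Sum>s\<in>S. fair_mass H0 s * (1 + (1 / fair_mass H0 s)\<^sup>2))"
  using sum_sign_mass_AE sign_mass_zero_AE
proof eventually_elim
  case (elim \<omega>)
  note sum1 = elim(1) and ac = elim(2)
  have KL: "sign_KL \<omega> = (\<Sum>s\<in>S. sign_mass s \<omega> * ln (sign_mass s \<omega> / fair_mass H0 s))"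
    by (rule trans[OF sign_KL_eq if_P[OF ac]])
  have le1: "sign_mass s \<omega> \<le> 1" if "s \<in> S" for s
    using member_le_sum[of s S "\<lambda>s. sign_mass s \<omega>"] that sum1 by simp
  have "sign_tv \<omega> \<le> sqrt (sign_KL \<omega> / 2)"
    unfolding sign_tv_eq KL using ac sum1
    by (intro cSUP_least pinsker_finite) (auto simp: sum_fair_mass[OF finite_nulls])
  moreover have "sign_tv \<omega> \<le> 1"
    unfolding sign_tv_eq
  proof (rule cSUP_least)
    fix A assume "A \<in> Pow S"
    then have A: "(\<Sum>s\<in>A. sign_mass s \<omega>) \<le> (\<Sum>s\<in>S. sign_mass s \<omega>)"
      "(\<Sum>s\<in>A. fair_mass H0 s) \<le> (\<Sum>s\<in>S. fair_mass H0 s)"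
      by (auto intro!: sum_mono2)
    have "0 \<le> (\<Sum>s\<in>A. sign_mass s \<omega>)" "0 \<le> (\<Sum>s\<in>A. fair_mass H0 s)"
      by (auto intro!: sum_nonneg)
    with A show "\<bar>(\<Sum>s\<in>A. sign_mass s \<omega>) - (\<Sum>s\<in>A. fair_mass H0 s)\<bar> \<le> 1"
      using sum1 sum_fair_mass[OF finite_nulls] by linarith
  qed auto
  moreover have "\<bar>sign_KL \<omega>\<bar> \<le> (\<Sum>s\<in>S. fair_mass H0 s * (1 + (1 / fair_mass H0 s)\<^sup>2))"
    unfolding KL
  proof (rule order_trans[OF sum_abs sum_mono])
    fix s assume s: "s \<in> S"
    show "\<bar>sign_mass s \<omega> * ln (sign_mass s \<omega> / fair_mass H0 s)\<bar>
        \<le> fair_mass H0 s * (1 + (1 / fair_mass H0 s)\<^sup>2)"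
    proof (cases "fair_mass H0 s = 0")
      case True
      with ac s show ?thesis by simp
    next
      case False
      then have pos: "0 < fair_mass H0 s" using fair_mass_nonneg[of H0 s] by linarith
      let ?x = "sign_mass s \<omega> / fair_mass H0 s"
      have "\<bar>sign_mass s \<omega> * ln ?x\<bar> = fair_mass H0 s * \<bar>?x * ln ?x\<bar>"
        using pos by (simp add: abs_mult)
      also have "\<dots> \<le> fair_mass H0 s * (1 + ?x\<^sup>2)"
        using pos by (intro mult_left_mono abs_xlnx_le) auto
      \<comment> \<open>The conditional mass is at most 1, so the likelihood ratio is at most the
        reciprocal of the fair mass, a bound free of the outcome.\<close>
      also have "\<dots> \<le> fair_mass H0 s * (1 + (1 / fair_mass H0 s)\<^sup>2)"
        using pos le1[OF s] by (intro mult_left_mono add_left_mono power_mono divide_right_mono) auto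
      finally show ?thesis .
    qed
  qed
  ultimately show ?case by simp
qed

lemma integrable_sign_tv: "integrable M sign_tv"
  using sign_law_AE sign_tv_nonneg
  by (intro integrable_const_bound[where B = 1]) auto

lemma integrable_sign_KL: "integrable M sign_KL"
  using sign_law_AE
  by (intro integrable_const_bound[where B = "\<Sum>s\<in>S. fair_mass H0 s * (1 + (1 / fair_mass H0 s)\<^sup>2)"]) auto

lemma FDR_le_d_sign: "FDR M I H0 W q \<le> q + d_sign M I H0 W"
proof -
  have "FDR M I H0 W q \<le> (\<integral>\<omega>. q + sign_tv \<omega> \<partial>M)"
    unfolding FDR_eq_sum_sign_score(2)
    by (intro integral_mono FDR_eq_sum_sign_score(1) sum_sign_score_le
        Bochner_Integration.integrable_add integrable_sign_tv) simp
  also have "\<dots> = q + d_sign M I H0 W"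
    unfolding d_sign_def using integrable_sign_tv
    by (subst Bochner_Integration.integral_add) (auto simp: prob_space)
  finally show ?thesis .
qed

lemma d_sign_le_sqrt_K_sign: "d_sign M I H0 W \<le> sqrt (K_sign M I H0 W / 2)"
proof -
  have "AE \<omega> in M. norm ((sign_tv \<omega>)\<^sup>2) \<le> 1"
    using sign_law_AE by eventually_elim (simp add: power_le_one sign_tv_nonneg)
  then have int2: "integrable M (\<lambda>\<omega>. (sign_tv \<omega>)\<^sup>2)"
    by (rule integrable_const_bound) measurable
  \<comment> \<open>Jensen's inequality for the square, in the form that the variance is
    nonnegative.\<close>
  have "(d_sign M I H0 W)\<^sup>2 \<le> (\<integral>\<omega>. (sign_tv \<omega>)\<^sup>2 \<partial>M)"
    using variance_eq[OF integrable_sign_tv int2] variance_positive[of sign_tv]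
    unfolding d_sign_def by linarith
  also have "\<dots> \<le> (\<integral>\<omega>. sign_KL \<omega> / 2 \<partial>M)"
  proof (rule integral_mono_AE)
    show "AE \<omega> in M. (sign_tv \<omega>)\<^sup>2 \<le> sign_KL \<omega> / 2"
      using sign_law_AE
    proof eventually_elim
      case (elim \<omega>)
      \<comment> \<open>\<open>sqrt\<close> is negative at negative arguments, so this lower bound
        shows that the divergence is nonnegative and licenses squaring the root.\<close>
      then have "0 \<le> sqrt (sign_KL \<omega> / 2)" using sign_tv_nonneg[of \<omega>] by linarith
      then have "(sqrt (sign_KL \<omega> / 2))\<^sup>2 = sign_KL \<omega> / 2" by (simp only: real_sqrt_ge_0_iff real_sqrt_pow2)
      then show ?case using power_mono[of "sign_tv \<omega>" "sqrt (sign_KL \<omega> / 2)" 2] elim sign_tv_nonneg[of \<omega>]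
        by simp
    qed
  qed (use int2 integrable_sign_KL in auto)
  also have "\<dots> = K_sign M I H0 W / 2" by (simp add: K_sign_def)
  finally show ?thesis by (rule real_le_rsqrt)
qed

end

end

theorem proposition8:
  fixes M :: "'a measure" and W :: "nat \<Rightarrow> 'a \<Rightarrow> real"
    and m :: nat and H0 :: "nat set" and q :: real
  assumes "prob_space M"
    and "0 < q" and "q < 1"
    and "\<And>i. i \<in> {1..m} \<Longrightarrow> W i \<in> borel_measurable M"
    and "H0 \<subseteq> {1..m}"
    and "\<And>j. j \<in> H0 \<Longrightarrow> AE \<omega> in M. W j \<omega> \<noteq> 0"
  shows "FDR M {1..m} H0 W q \<le> q + d_sign M {1..m} H0 W \<and>
         q + d_sign M {1..m} H0 W \<le> q + sqrt (K_sign M {1..m} H0 W / 2) \<and>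
         (\<forall>\<epsilon>::real. \<epsilon> \<ge> 0 \<longrightarrow>
            FDR M {1..m} H0 W q
              \<le> exp \<epsilon> * q + measure M {\<omega> \<in> space M. Lambda_max M {1..m} H0 W \<omega> > ereal \<epsilon>}) \<and>
         ((\<forall>j\<in>H0. AE \<omega> in M. pos_prob M {1..m} W j \<omega> > 0 \<and> neg_prob M {1..m} W j \<omega> > 0) \<longrightarrow>
            ennreal (FDR M {1..m} H0 W q) \<le> ennreal q * I_q M {1..m} H0 W q \<and>
            ennreal q * I_q M {1..m} H0 W q \<le> ennreal q * M_minus M {1..m} H0 W)"
proof -
  interpret knockoff_scores M "{1..m}" H0 W q
  proof (intro knockoff_scores.intro knockoff_scores_axioms.intro assms(1,4,5))
    show "0 \<le> q" using \<open>0 < q\<close> by simp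
  qed auto
  show ?thesis
  proof (intro conjI allI impI)
    show "FDR M {1..m} H0 W q \<le> q + d_sign M {1..m} H0 W"
      by (rule FDR_le_d_sign[OF assms(6)])
    show "q + d_sign M {1..m} H0 W \<le> q + sqrt (K_sign M {1..m} H0 W / 2)"
      by (rule add_left_mono[OF d_sign_le_sqrt_K_sign[OF assms(6)]])
    show "FDR M {1..m} H0 W q
        \<le> exp \<epsilon> * q + measure M {\<omega> \<in> space M. Lambda_max M {1..m} H0 W \<omega> > ereal \<epsilon>}" for \<epsilon>
      by (rule FDR_le_exp_Lambda_max)
    show "ennreal q * I_q M {1..m} H0 W q \<le> ennreal q * M_minus M {1..m} H0 W"
      by (rule mult_left_mono[OF I_q_le_M_minus]) simp
    assume "\<forall>j\<in>H0. AE \<omega> in M. pos_prob M {1..m} W j \<omega> > 0 \<and> neg_prob M {1..m} W j \<omega> > 0"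
    then show "ennreal (FDR M {1..m} H0 W q) \<le> ennreal q * I_q M {1..m} H0 W q"
      by (intro FDR_le_I_q) blast
  qed
qed

end
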